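(* Let $(R,\mathfrak m)$ be the localization, at the homogeneous maximal ideal, of a polynomial ring in $d$ variables over a field of prime characteristic $p$, where $d$ is at least two. Take $J=\mathfrak m^t$ and $I=\mathfrak m$. Then for large enough $t$, $$e_{HK}(J,R)>\left(\frac{c^J(I)}d\right)^d e_{HK}\!\left(J\tfrac RI,\tfrac RI\right).$$ Thus for large $t$ the following assertion, conjectured by Smirnov and Betancourt for all noetherian local rings $(R,\mathfrak m)$ of prime characteristic, all parts of systems of parameters $f_1,\dots,f_r$ with $I=(f_1,\dots,f_r)R$, and all $\mathfrak m$-primary ideals $J$, fails: $e_{HK}(J,R)\le\left(\frac{c^J(I)}r\right)^re_{HK}\!\left(J\tfrac RI,\tfrac RI\right)$.
   Context: For a local ring $A$ of characteristic $p$ and a proper ideal $\mathfrak a$ with $A/\mathfrak a$ of finite length, $e_{HK}(\mathfrak a,A)=\lim_{n\to\infty}l(A/\mathfrak a^{[p^n]})/p^{n\dim A}$, where $\mathfrak a^{[p^n]}$ is the ideal generated by $p^n$-th powers of elements of $\mathfrak a$ and $l$ is length. The $F$-threshold is $c^J(I)=\lim_{n\to\infty}\frac1{p^n}\sup\{t'\in\mathbb N: I^{t'}\nsubseteq J^{[p^n]}\}$. *)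

theory Defs
  imports
    "HOL-Algebra.Algebra"
    "HOL-Library.Extended_Nat"
    "HOL-Library.Poly_Mapping"
    "HOL-Computational_Algebra.Computational_Algebra"
begin

section \<open>Dimension and length\<close>

definition chain_sup :: "('a set \<Rightarrow> bool) \<Rightarrow> enat" where
  "chain_sup Q = Sup {enat n | n. \<exists>C :: nat \<Rightarrow> 'a set.
     (\<forall>i\<le>n. Q (C i)) \<and> (\<forall>i<n. C i \<subset> C (Suc i))}"

definition krull_dim :: "('a, 'b) ring_scheme \<Rightarrow> enat" where
  "krull_dim A = chain_sup (\<lambda>P. primeideal P A)"

definition module_length ::
    "('a, 'b) ring_scheme \<Rightarrow> ('a, 'c, 'e) module_scheme \<Rightarrow> enat" where
  "module_length A M = chain_sup (\<lambda>N. submodule N A M)"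

text \<open>The quotient ring of \<open>A\<close> by \<open>\<aa>\<close>, viewed as an \<open>A\<close>-module through
  the projection \<open>r \<mapsto> \<aa> + r\<close>.\<close>

definition quot_module :: "('a, 'b) ring_scheme \<Rightarrow> 'a set \<Rightarrow> ('a, 'a set) module" where
  "quot_module A \<aa> = ring.extend (A Quot \<aa>)
     (module.fields (\<lambda>r y. (\<aa> +>\<^bsub>A\<^esub> r) \<otimes>\<^bsub>A Quot \<aa>\<^esub> y))"


section \<open>Hilbert--Kunz multiplicity and \<open>F\<close>-threshold\<close>

abbreviation ideal_power :: "('a, 'b) ring_scheme \<Rightarrow> 'a set \<Rightarrow> nat \<Rightarrow> 'a set" where
  "ideal_power A \<aa> t \<equiv> \<aa> [^]\<^bsub>ideals_set A\<^esub> t"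

definition frobenius_power :: "('a, 'b) ring_scheme \<Rightarrow> 'a set \<Rightarrow> nat \<Rightarrow> 'a set" where
  "frobenius_power A \<aa> q = Idl\<^bsub>A\<^esub> {x [^]\<^bsub>A\<^esub> q | x. x \<in> \<aa>}"

text \<open>The coercion \<open>the_enat\<close> is meaningful when the length and the dimension are finite,
  as they are for an ideal primary to the maximal ideal of a noetherian local ring.\<close>

definition e_HK :: "nat \<Rightarrow> ('a, 'b) ring_scheme \<Rightarrow> 'a set \<Rightarrow> real" where
  "e_HK p A \<aa> = lim (\<lambda>n.
     real (the_enat (module_length A (quot_module A (frobenius_power A \<aa> (p ^ n)))))
       / real p ^ (n * the_enat (krull_dim A)))"

text \<open>The argument order is that of \<open>c\<^sup>J(I)\<close>: first \<open>J\<close>, then \<open>I\<close>. The supremum is one of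
  natural numbers, hence meaningful only when the set is bounded, i.e. when some power
  of \<open>I\<close> lies in \<open>J\<close> (for finitely generated \<open>I\<close>).\<close>

definition F_threshold :: "nat \<Rightarrow> ('a, 'b) ring_scheme \<Rightarrow> 'a set \<Rightarrow> 'a set \<Rightarrow> real" where
  "F_threshold p A J I = lim (\<lambda>n.
     real (Sup {s. \<not> ideal_power A I s \<subseteq> frobenius_power A J (p ^ n)}) / real p ^ n)"

text \<open>The extension of \<open>J\<close> to the quotient ring of \<open>A\<close> by \<open>I\<close>.\<close>

definition quot_extension :: "('a, 'b) ring_scheme \<Rightarrow> 'a set \<Rightarrow> 'a set \<Rightarrow> 'a set set" where
  "quot_extension A I J = Idl\<^bsub>A Quot I\<^esub> ((\<lambda>a. I +>\<^bsub>A\<^esub> a) ` J)"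


section \<open>The conjectured inequality\<close>

definition noetherian_local :: "('a, 'b) ring_scheme \<Rightarrow> 'a set \<Rightarrow> bool" where
  "noetherian_local A \<mm> \<longleftrightarrow>
     cring A \<and> noetherian_ring A \<and> {M. maximalideal M A} = {\<mm>}"

definition ideal_radical :: "('a, 'b) ring_scheme \<Rightarrow> 'a set \<Rightarrow> 'a set" where
  "ideal_radical A \<aa> = {x \<in> carrier A. \<exists>n::nat. x [^]\<^bsub>A\<^esub> n \<in> \<aa>}"

definition primary_to :: "('a, 'b) ring_scheme \<Rightarrow> 'a set \<Rightarrow> 'a set \<Rightarrow> bool" where
  "primary_to A \<mm> \<aa> \<longleftrightarrow>
     ideal \<aa> A \<and> \<aa> \<noteq> carrier A \<and>
     (\<forall>x\<in>carrier A. \<forall>y\<in>carrier A.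
        x \<otimes>\<^bsub>A\<^esub> y \<in> \<aa> \<longrightarrow> x \<in> \<aa> \<or> y \<in> ideal_radical A \<aa>) \<and>
     ideal_radical A \<aa> = \<mm>"

definition part_of_sop :: "('a, 'b) ring_scheme \<Rightarrow> 'a set \<Rightarrow> 'a list \<Rightarrow> bool" where
  "part_of_sop A \<mm> fs \<longleftrightarrow>
     (\<exists>gs. set (fs @ gs) \<subseteq> \<mm> \<and> enat (length (fs @ gs)) = krull_dim A \<and>
        primary_to A \<mm> (Idl\<^bsub>A\<^esub> (set (fs @ gs))))"

text \<open>The conjecture of Smirnov and Betancourt is that \<open>SB_hypotheses\<close> implies
  \<open>SB_inequality\<close>, for all \<open>p\<close>, \<open>A\<close>, \<open>fs\<close> and \<open>J\<close>. The list \<open>fs\<close> is required to be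
  nonempty because the inequality divides by its length.\<close>

definition SB_hypotheses ::
    "nat \<Rightarrow> ('a, 'b) ring_scheme \<Rightarrow> 'a set \<Rightarrow> 'a list \<Rightarrow> 'a set \<Rightarrow> bool" where
  "SB_hypotheses p A \<mm> fs J \<longleftrightarrow>
     Factorial_Ring.prime p \<and> noetherian_local A \<mm> \<and> add_pow A p \<one>\<^bsub>A\<^esub> = \<zero>\<^bsub>A\<^esub> \<and>
     fs \<noteq> [] \<and> part_of_sop A \<mm> fs \<and> primary_to A \<mm> J"

definition SB_inequality ::
    "nat \<Rightarrow> ('a, 'b) ring_scheme \<Rightarrow> 'a list \<Rightarrow> 'a set \<Rightarrow> bool" where
  "SB_inequality p A fs J \<longleftrightarrow>
     (let r = length fs; I = Idl\<^bsub>A\<^esub> (set fs) in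
      e_HK p A J \<le>
        (F_threshold p A J I / real r) ^ r * e_HK p (A Quot I) (quot_extension A I J))"


section \<open>The localized polynomial ring\<close>

text \<open>Polynomials over \<open>'k\<close> in the variables \<open>X\<^sub>i\<close>, \<open>i < d\<close>, form a subring of the
  monoid algebra of finitely supported exponent vectors \<open>nat \<Rightarrow>\<^sub>0 nat\<close>.\<close>

type_synonym 'k poly_nat_vars = "(nat \<Rightarrow>\<^sub>0 nat) \<Rightarrow>\<^sub>0 'k"

definition polys :: "nat \<Rightarrow> ('k::field) poly_nat_vars set" where
  "polys d = {f. \<forall>e \<in> Poly_Mapping.keys f. Poly_Mapping.keys e \<subseteq> {..<d}}"

text \<open>The span of the monomials of positive degree, i.e. the vanishing of the constant term.\<close>

definition homogeneous_max :: "nat \<Rightarrow> ('k::field) poly_nat_vars set" where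
  "homogeneous_max d = {f \<in> polys d. Poly_Mapping.lookup f 0 = 0}"

text \<open>Since the polynomial ring is a domain, its localization is realized inside the
  fraction field.\<close>

definition loc_ring :: "nat \<Rightarrow> ('k::field) poly_nat_vars fract ring" where
  "loc_ring d =
     \<lparr>carrier = {Fract f g | f g. f \<in> polys d \<and> g \<in> polys d - homogeneous_max d},
      monoid.mult = (*), one = 1, ring.zero = 0, add = (+)\<rparr>"

definition loc_max :: "nat \<Rightarrow> ('k::field) poly_nat_vars fract set" where
  "loc_max d = {Fract f g | f g. f \<in> homogeneous_max d \<and> g \<in> polys d - homogeneous_max d}"

definition loc_var :: "nat \<Rightarrow> ('k::field) poly_nat_vars fract" where
  "loc_var i = Fract (Poly_Mapping.single (Poly_Mapping.single i 1) 1) 1"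

end

theory Submission
  imports Defs
begin

text \<open>
  Powers of \<open>\<mm>\<close>, and in characteristic \<open>p\<close> their Frobenius powers, are monomial ideals, so every
  invariant reduces to counting exponents: \<open>x\<^sup>e\<close> lies in \<open>\<mm>\<^sup>t\<close> iff \<open>\<Sum>e\<^sub>i \<ge> t\<close>, and in the \<open>q\<close>-th
  Frobenius power of \<open>\<mm>\<^sup>t\<close> iff \<open>\<Sum>(e\<^sub>i div q) \<ge> t\<close>. Splitting each exponent into quotient and remainder
  modulo \<open>q\<close> shows that the latter has colength \<open>q\<^sup>d\<close> times the binomial coefficient
  \<open>t - 1 + d choose d\<close>, while \<open>\<mm>\<^sup>s\<close> is not contained in it iff \<open>s \<le> q (t - 1) + d (q - 1)\<close>.
  Hence \<open>e_HK(\<mm>\<^sup>t) = (t - 1 + d choose d)\<close> and the \<open>F\<close>-threshold is \<open>t - 1 + d\<close>; the residue field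
  contributes \<open>1\<close>. The claim becomes \<open>(n / d)\<^sup>d < (n choose d)\<close> for \<open>n = t - 1 + d > d \<ge> 2\<close>, so
  \<open>t \<ge> 2\<close> suffices. That \<open>R\<close> has dimension at most \<open>d\<close> follows from the algebraic dependence of
  \<open>d + 1\<close> polynomials in \<open>d\<close> variables, evaluated along a chain of primes.
\<close>

section \<open>Length from a composition series\<close>

text \<open>The lengths come out exactly: for every n the colength of the p^n-th Frobenius power is
  the binomial coefficient times p^(nd), so once the dimension is known to be d the Hilbert-Kunz
  sequence is constant. Only the F-threshold is a genuine limit, approached with defect d / p^n.
  Passing to the localization costs nothing, since a denominator has nonzero constant term and
  therefore cannot bring a new monomial into a monomial ideal. The choice I = m turns the last
  factor into an invariant of the residue field. The binomial inequality compares factors: C(n,d) is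
  the product of (n - i) / (d - i) over i < d, and each factor with i > 0 exceeds n / d, so
  strictness comes from d >= 2 and n > d. The larger share of the work shows that the ring satisfies
  the hypotheses of the conjecture. Noetherianity is obtained as in Groebner basis theory, from
  Dickson's lemma for leading exponents; the dimension is needed both to normalize the Hilbert-Kunz
  multiplicity and to see that the variables form a system of parameters.\<close>

lemma chain_sup_eqI:
  assumes "\<And>i. i \<le> N \<Longrightarrow> Q (C i)" "\<And>i. i < N \<Longrightarrow> C i \<subset> C (Suc i)"
    and "\<And>n C. (\<And>i. i \<le> n \<Longrightarrow> Q (C i)) \<Longrightarrow> (\<And>i. i < n \<Longrightarrow> C i \<subset> C (Suc i)) \<Longrightarrow> n \<le> N"
  shows "chain_sup Q = enat N"
  unfolding chain_sup_def
proof (rule antisym)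
  show "Sup {enat n | n. \<exists>C. (\<forall>i\<le>n. Q (C i)) \<and> (\<forall>i<n. C i \<subset> C (Suc i))} \<le> enat N"
  proof (rule Sup_least, clarify)
    fix n C assume "\<forall>i\<le>n. Q (C i)" "\<forall>i<n. C i \<subset> C (Suc i)"
    then show "enat n \<le> enat N" using assms(3)[of n C] by simp
  qed
  show "enat N \<le> Sup {enat n | n. \<exists>C. (\<forall>i\<le>n. Q (C i)) \<and> (\<forall>i<n. C i \<subset> C (Suc i))}"
    using assms(1,2) by (intro Sup_upper) blast
qed

text \<open>Addition in \<open>quot_module\<close> is inherited from the quotient ring and scalars
  act through the projection, so submodules can be recognized inside the quotient ring
  alone.\<close>

lemma submodule_quot_module_iff:
  "submodule N A (quot_module A I) \<longleftrightarrow>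
     subgroup N (add_monoid (A Quot I)) \<and>
     (\<forall>r\<in>carrier A. \<forall>y\<in>N. (I +>\<^bsub>A\<^esub> r) \<otimes>\<^bsub>A Quot I\<^esub> y \<in> N)"
  by (auto simp: submodule_def submodule_axioms_def quot_module_def ring.defs module.defs
      subgroup_def m_inv_def)

lemma strict_chain_le_card:
  assumes "finite B" "\<And>i. i \<le> n \<Longrightarrow> S i \<subseteq> B" "\<And>i. i < n \<Longrightarrow> S i \<subset> S (Suc i)"
  shows "n \<le> card B"
proof -
  have "i \<le> n \<Longrightarrow> i \<le> card (S i)" for i
  proof (induction i)
    case (Suc i)
    then have "card (S i) < card (S (Suc i))"
      using assms by (meson Suc_le_lessD finite_subset psubset_card_mono)
    with Suc show ?case by simp
  qed simp
  from this[of n] show ?thesis using assms(1,2) card_mono[of B "S n"] by force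
qed

text \<open>The indices \<open>i\<close> at which a submodule meets \<open>K (Suc i) - K i\<close> determine it among the
  submodules of a larger one; hence no chain is longer than the composition series \<open>K\<close>.\<close>

lemma module_length_quot_module:
  fixes A (structure)
  assumes "cring A" and ideals: "\<And>i. i \<le> N \<Longrightarrow> ideal (K i) A" and top: "K N = carrier A"
    and strict: "\<And>i. i < N \<Longrightarrow> K i \<subset> K (Suc i)"
    and simple: "\<And>i x y. \<lbrakk>i < N; y \<in> K (Suc i) - K i; x \<in> K (Suc i)\<rbrakk> \<Longrightarrow>
       \<exists>c\<in>carrier A. x \<ominus> c \<otimes> y \<in> K i"
  shows "module_length A (quot_module A (K 0)) = enat N"
proof -
  interpret cring A by fact
  define I where "I = K 0"
  interpret I: ideal I A using ideals[of 0] by (simp add: I_def)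
  interpret h: ring_hom_ring A "A Quot I" "(+>) I" by (rule I.rcos_ring_hom_ring)
  let ?Q = "A Quot I" and ?h = "(+>) I"
  \<comment> \<open>An ideal containing \<open>I\<close> is a union of cosets of \<open>I\<close>,
    so the projection forgets nothing about it and strict inclusions survive in the
    quotient.\<close>
  have mem_of_coset: "x \<in> L" if "ideal L A" "I \<subseteq> L" "y \<in> L" "?h x = ?h y" "x \<in> carrier A" for x y L
  proof -
    interpret L: ideal L A by fact
    have y: "y \<in> carrier A" using that L.Icarr by blast
    have "x \<in> ?h y" using I.a_rcos_self[OF that(5)] that(4) by simp
    then obtain a where "a \<in> I" "x = a \<oplus> y" using y by (auto simp: a_r_coset_def')
    then show ?thesis using that additive_subgroup.a_closed[OF L.additive_subgroup_axioms] by blast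
  qed
  have "chain_sup (\<lambda>M. submodule M A (quot_module A I)) = enat N"
  proof (rule chain_sup_eqI)
    have K: "I \<subseteq> K i" if "i \<le> N" for i
      using that
    proof (induction i)
      case (Suc i)
      then show ?case using strict[of i] by auto
    qed (simp add: I_def)
    fix i
    show "submodule (?h ` K i) A (quot_module A I)" if "i \<le> N"
    proof -
      interpret K: ideal "K i" A using ideals[OF that] .
      have "subgroup (?h ` K i) (add_monoid ?Q)"
      proof (rule group.subgroupI)
        show "group (add_monoid ?Q)" by (rule h.S.add.group_axioms)
        show "inv\<^bsub>add_monoid ?Q\<^esub> a \<in> ?h ` K i" if "a \<in> ?h ` K i" for a
        proof -
          from that obtain x where "x \<in> K i" "a = ?h x" by blast
          then have "inv\<^bsub>add_monoid ?Q\<^esub> a = ?h (\<ominus> x)" "\<ominus> x \<in> K i"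
            using h.hom_a_inv[of x] additive_subgroup.a_inv_closed[OF K.additive_subgroup_axioms]
            by (auto simp: a_inv_def[of "A Quot I"] K.a_Hcarr)
          then show ?thesis by blast
        qed
        show "a \<otimes>\<^bsub>add_monoid ?Q\<^esub> b \<in> ?h ` K i" if ab: "a \<in> ?h ` K i" "b \<in> ?h ` K i" for a b
        proof -
          from ab obtain x y where "x \<in> K i" "y \<in> K i" "a = ?h x" "b = ?h y" by blast
          then have "a \<otimes>\<^bsub>add_monoid ?Q\<^esub> b = ?h (x \<oplus> y)" "x \<oplus> y \<in> K i"
            using additive_subgroup.a_closed[OF K.additive_subgroup_axioms] by (auto simp: K.a_Hcarr)
          then show ?thesis by blast
        qed
      next
        show "?h ` K i \<noteq> {}"
          using additive_subgroup.zero_closed[OF K.additive_subgroup_axioms] by blast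
      qed (use K.a_Hcarr in auto)
      moreover have "?h r \<otimes>\<^bsub>?Q\<^esub> y \<in> ?h ` K i" if "r \<in> carrier A" "y \<in> ?h ` K i" for r y
      proof -
        from that obtain x where "x \<in> K i" "y = ?h x" by blast
        then have "?h r \<otimes>\<^bsub>?Q\<^esub> y = ?h (r \<otimes> x)" "r \<otimes> x \<in> K i"
          using that(1) by (auto simp: K.a_Hcarr K.I_l_closed)
        then show ?thesis by blast
      qed
      ultimately show ?thesis by (simp add: submodule_quot_module_iff)
    qed
    show "?h ` K i \<subset> ?h ` K (Suc i)" if "i < N"
    proof -
      obtain x where x: "x \<in> K (Suc i)" "x \<notin> K i" using strict[OF \<open>i < N\<close>] by blast
      have "x \<in> carrier A"
        using x(1) ideals[of "Suc i"] that ideal.Icarr by fastforce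
      then have "?h x \<notin> ?h ` K i"
        using mem_of_coset[OF ideals[of i] K[of i]] x that by auto
      then show ?thesis using strict[OF that] x by blast
    qed
  next
    fix n C
    assume sub: "\<And>i. i \<le> n \<Longrightarrow> submodule (C i) A (quot_module A I)"
      and C: "\<And>i. i < n \<Longrightarrow> C i \<subset> C (Suc i)"
    \<comment> \<open>Pulling the chain back to \<open>A\<close> makes it comparable with the series
      \<open>K\<close>, which consists of ideals of \<open>A\<close>.\<close>
    define L where "L i = {x \<in> carrier A. ?h x \<in> C i}" for i
    define S where "S i = {j. j < N \<and> (\<exists>y\<in>L i. y \<in> K (Suc j) - K j)}" for i
    have Cg: "subgroup (C i) (add_monoid ?Q)"
      and Cs: "\<And>r y. r \<in> carrier A \<Longrightarrow> y \<in> C i \<Longrightarrow> ?h r \<otimes>\<^bsub>?Q\<^esub> y \<in> C i"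
      if "i \<le> n" for i
      using sub[OF that] by (auto simp: submodule_quot_module_iff)
    have L_add: "x \<oplus> y \<in> L i" if "i \<le> n" "x \<in> L i" "y \<in> L i" for i x y
      using that subgroup.m_closed[OF Cg[OF that(1)]] by (auto simp: L_def)
    have L_smult: "r \<otimes> x \<in> L i" if "i \<le> n" "r \<in> carrier A" "x \<in> L i" for i r x
      using that Cs[OF that(1,2)] by (auto simp: L_def)
    have L_0: "I \<subseteq> L i" if "i \<le> n" for i
    proof
      fix x assume "x \<in> I"
      then have "x \<in> carrier A" "?h x = \<zero>\<^bsub>?Q\<^esub>"
        using I.Icarr I.a_rcos_const[OF \<open>x \<in> I\<close>] by (simp_all only: FactRing_def ring.simps)
      moreover have "\<zero>\<^bsub>?Q\<^esub> \<in> C i" using subgroup.one_closed[OF Cg[OF that]] by simp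
      ultimately show "x \<in> L i" by (simp add: L_def)
    qed
    have "S i \<subset> S (Suc i)" if i: "i < n" for i
    proof -
      have LL: "L i \<subseteq> L (Suc i)" using C[OF i] by (auto simp: L_def)
      then have "S i \<subseteq> S (Suc i)" by (auto simp: S_def)
      moreover have "S i \<noteq> S (Suc i)"
      proof
        assume eq: "S i = S (Suc i)"
        \<comment> \<open>Climb the series \<open>K\<close>: if \<open>x\<close> from the larger
          module enters at layer \<open>j\<close>, equality of the index sets supplies
          \<open>y\<close> from the smaller one entering there too, and subtracting a multiple of
          \<open>y\<close> drops \<open>x\<close> into \<open>K j\<close>.\<close>
        have "j \<le> N \<Longrightarrow> L (Suc i) \<inter> K j \<subseteq> L i" for j
        proof (induction j)
          case 0
          then show ?case using L_0[of i] i by (auto simp: I_def)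
        next
          case (Suc j)
          show ?case
          proof
            fix x assume x: "x \<in> L (Suc i) \<inter> K (Suc j)"
            show "x \<in> L i"
            proof (cases "x \<in> K j")
              case True
              then show ?thesis using Suc x by auto
            next
              case False
              then have "j \<in> S i" using x Suc.prems unfolding eq by (auto simp: S_def)
              then obtain y where y: "y \<in> L i" "y \<in> K (Suc j) - K j" by (auto simp: S_def)
              then obtain c where c: "c \<in> carrier A" "x \<ominus> c \<otimes> y \<in> K j"
                using simple[of j y x] x Suc.prems by auto
              have carr: "x \<in> carrier A" "y \<in> carrier A" using x y by (auto simp: L_def)
              have "(\<ominus> c) \<otimes> y \<in> L (Suc i)"
                using y LL c i by (intro L_smult) auto
              then have "x \<oplus> (\<ominus> c) \<otimes> y \<in> L (Suc i)" using x i by (intro L_add) auto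
              then have "x \<ominus> c \<otimes> y \<in> L (Suc i)"
                using carr c by (simp add: a_minus_def l_minus)
              then have "x \<ominus> c \<otimes> y \<in> L i" using Suc c by auto
              then have "(x \<ominus> c \<otimes> y) \<oplus> c \<otimes> y \<in> L i"
                using i c y by (intro L_add L_smult) auto
              also have "(x \<ominus> c \<otimes> y) \<oplus> c \<otimes> y = x"
                using carr c by (simp add: a_minus_def a_assoc l_neg)
              finally show ?thesis .
            qed
          qed
        qed
        from this[of N] have "L (Suc i) \<subseteq> L i" by (auto simp: top L_def)
        moreover obtain z where z: "z \<in> C (Suc i)" "z \<notin> C i" using C[OF i] by blast
        moreover have "C (Suc i) \<subseteq> carrier ?Q"
          using subgroup.subset[OF Cg[of "Suc i"]] i unfolding partial_object.simps by simp
        then have "z \<in> carrier ?Q" using z(1) by blast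
        then obtain x where "x \<in> carrier A" "z = ?h x" unfolding FactRing_simps by auto
        ultimately show False unfolding L_def by blast
      qed
      ultimately show ?thesis by blast
    qed
    then have "n \<le> card {..<N}"
      by (intro strict_chain_le_card[of _ n S]) (auto simp: S_def)
    then show "n \<le> N" by simp
  qed
  then show ?thesis by (simp add: module_length_def I_def)
qed

section \<open>Monomial ideals of the localized polynomial ring\<close>

definition exps :: "nat \<Rightarrow> (nat \<Rightarrow>\<^sub>0 nat) set" where
  "exps d = {e. Poly_Mapping.keys e \<subseteq> {..<d}}"

definition denoms :: "nat \<Rightarrow> 'k::field poly_nat_vars set" where
  "denoms d = {g \<in> polys d. Poly_Mapping.lookup g 0 \<noteq> 0}"

definition exps_ideal :: "nat \<Rightarrow> (nat \<Rightarrow>\<^sub>0 nat) set \<Rightarrow> bool" where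
  "exps_ideal d U \<longleftrightarrow> U \<subseteq> exps d \<and> (\<forall>e\<in>U. \<forall>a\<in>exps d. a + e \<in> U)"

text \<open>For \<open>U\<close> satisfying \<open>exps_ideal\<close> this is the extension to the
  localization of the monomial ideal spanned by \<open>U\<close>. The whole ring is the case
  \<open>U = exps d\<close>, so ring and ideals share the same closure lemmas.\<close>

definition mono_ideal :: "nat \<Rightarrow> (nat \<Rightarrow>\<^sub>0 nat) set \<Rightarrow> 'k::field poly_nat_vars fract set" where
  "mono_ideal d U = {Fract f g | f g. Poly_Mapping.keys f \<subseteq> U \<and> g \<in> denoms d}"

definition const :: "'k::field \<Rightarrow> 'k poly_nat_vars" where
  "const c = Poly_Mapping.single 0 c"

definition monom :: "(nat \<Rightarrow>\<^sub>0 nat) \<Rightarrow> 'k::field poly_nat_vars" where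
  "monom e = Poly_Mapping.single e 1"

lemma exps_0 [simp]: "0 \<in> exps d"
  by (simp add: exps_def)

lemma keys_add_exps: "Poly_Mapping.keys (a + b) = Poly_Mapping.keys a \<union> Poly_Mapping.keys b"
  for a b :: "nat \<Rightarrow>\<^sub>0 nat"
  by (auto simp: in_keys_iff lookup_add)

lemma exps_add [simp]: "a + b \<in> exps d \<longleftrightarrow> a \<in> exps d \<and> b \<in> exps d"
  by (auto simp: exps_def keys_add_exps)

lemma exps_single [simp]: "i < d \<Longrightarrow> Poly_Mapping.single i n \<in> exps d"
  by (auto simp: exps_def)

lemma exps_lookup: "e \<in> exps d \<Longrightarrow> i \<ge> d \<Longrightarrow> Poly_Mapping.lookup e i = 0"
  by (force simp: exps_def in_keys_iff)

lemma exps_idealI: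
  assumes "\<And>e. e \<in> U \<Longrightarrow> e \<in> exps d" "\<And>a e. a \<in> exps d \<Longrightarrow> e \<in> U \<Longrightarrow> a + e \<in> U"
  shows "exps_ideal d U"
  using assms by (auto simp: exps_ideal_def)

lemma exps_idealD: "exps_ideal d U \<Longrightarrow> e \<in> U \<Longrightarrow> a \<in> exps d \<Longrightarrow> a + e \<in> U"
  by (auto simp: exps_ideal_def)

lemma exps_ideal_subset: "exps_ideal d U \<Longrightarrow> U \<subseteq> exps d"
  by (auto simp: exps_ideal_def)

lemma exps_ideal_exps [simp]: "exps_ideal d (exps d)"
  by (auto simp: exps_ideal_def)

lemma polys_iff: "f \<in> polys d \<longleftrightarrow> Poly_Mapping.keys f \<subseteq> exps d"
  by (auto simp: polys_def exps_def)

lemma poly_mapping_eq_sum_single: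
  "f = (\<Sum>e\<in>Poly_Mapping.keys f. Poly_Mapping.single e (Poly_Mapping.lookup f e))"
  by (rule poly_mapping_eqI) (auto simp: lookup_sum lookup_single when_def in_keys_iff)

lemma poly_eq_sum_monom:
  "f = (\<Sum>e\<in>Poly_Mapping.keys f. const (Poly_Mapping.lookup f e) * monom e)"
  for f :: "'k::field poly_nat_vars"
  using poly_mapping_eq_sum_single[of f] by (simp add: const_def monom_def mult_single)

lemma keys_mult_subset:
  assumes "exps_ideal d U" "Poly_Mapping.keys f \<subseteq> U" "g \<in> polys d"
  shows "Poly_Mapping.keys (f * g) \<subseteq> U" "Poly_Mapping.keys (g * f) \<subseteq> U"
proof -
  show "Poly_Mapping.keys (g * f) \<subseteq> U"
    using keys_mult[of g f] assms by (auto simp: polys_iff dest: exps_idealD)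
  then show "Poly_Mapping.keys (f * g) \<subseteq> U" by (simp add: mult.commute)
qed

text \<open>The zero vector is a sum of two exponent vectors in only one way. Taking the constant
  term is evaluation at the origin, and its multiplicativity makes \<open>denoms d\<close> a
  multiplicative set.\<close>

lemma lookup_mult_0:
  "Poly_Mapping.lookup (f * g) 0 = Poly_Mapping.lookup f 0 * Poly_Mapping.lookup g 0"
  for f g :: "'k::field poly_nat_vars"
proof -
  have eq: "0 = l + q \<longleftrightarrow> l = 0 \<and> q = 0" for l q :: "nat \<Rightarrow>\<^sub>0 nat"
    by (metis add_0 keys_add_exps keys_eq_empty sup_eq_bot_iff)
  have "(\<Sum>q. Poly_Mapping.lookup g q when 0 = l + q) = (Poly_Mapping.lookup g 0 when l = 0)" for l
    by (cases "l = 0") (simp_all add: eq)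
  then show ?thesis by (simp add: lookup_mult mult_when)
qed

lemma lookup_monom_mult: "Poly_Mapping.lookup (monom e * g) (e + a) = Poly_Mapping.lookup g a"
proof -
  have "Poly_Mapping.lookup (monom e * g) (e + a) =
      (\<Sum>l. (\<Sum>q. Poly_Mapping.lookup g q when e + a = l + q) when l = e)"
    by (simp only: lookup_mult monom_def lookup_single when_mult mult_1 eq_commute[of e])
  also have "\<dots> = (\<Sum>q. Poly_Mapping.lookup g q when q = a)"
    by (simp only: Sum_any_when_equal add_left_cancel eq_commute[of a])
  finally show ?thesis by simp
qed

lemma keys_monom [simp]: "Poly_Mapping.keys (monom e) = {e}"
  by (simp add: monom_def)

lemma monom_mult: "monom a * monom b = monom (a + b)"
  by (simp add: monom_def mult_single)

lemma monom_0 [simp]: "monom 0 = 1"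
  by (simp add: monom_def)

lemma polys_intros [simp, intro]:
  "0 \<in> polys d" "1 \<in> polys d" "const c \<in> polys d"
  "e \<in> exps d \<Longrightarrow> monom e \<in> polys d"
  "f \<in> polys d \<Longrightarrow> - f \<in> polys d"
  by (auto simp: polys_iff const_def split: if_splits)

lemma polys_add [simp, intro]: "f \<in> polys d \<Longrightarrow> g \<in> polys d \<Longrightarrow> f + g \<in> polys d"
  using Poly_Mapping.keys_add[of f g] unfolding polys_iff by blast

lemma polys_mult [simp, intro]: "f \<in> polys d \<Longrightarrow> g \<in> polys d \<Longrightarrow> f * g \<in> polys d"
  using keys_mult_subset[of d "exps d" f g] by (simp add: polys_iff)

lemma polys_power [simp, intro]: "f \<in> polys d \<Longrightarrow> f ^ n \<in> polys d"
  by (induction n) auto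

lemma denoms_polys: "g \<in> denoms d \<Longrightarrow> g \<in> polys d"
  by (simp add: denoms_def)

lemma denoms_nonzero: "g \<in> denoms d \<Longrightarrow> g \<noteq> 0"
  using lookup_zero[of 0] unfolding denoms_def by blast

lemma denoms_1 [simp]: "1 \<in> denoms d"
  by (simp add: denoms_def)

lemma denoms_mult [simp]: "f \<in> denoms d \<Longrightarrow> g \<in> denoms d \<Longrightarrow> f * g \<in> denoms d"
  by (simp add: denoms_def lookup_mult_0)

lemma denoms_power [simp]: "f \<in> denoms d \<Longrightarrow> f ^ n \<in> denoms d"
  by (induction n) auto

lemma denoms_eq: "polys d - homogeneous_max d = denoms d"
  by (auto simp: denoms_def homogeneous_max_def)

lemma mono_idealI: "Poly_Mapping.keys f \<subseteq> U \<Longrightarrow> g \<in> denoms d \<Longrightarrow> Fract f g \<in> mono_ideal d U"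
  by (auto simp: mono_ideal_def)

lemma mono_idealE:
  assumes "x \<in> mono_ideal d U"
  obtains f g where "x = Fract f g" "Poly_Mapping.keys f \<subseteq> U" "g \<in> denoms d" "g \<noteq> 0"
  using assms denoms_nonzero unfolding mono_ideal_def by blast

lemma mono_ideal_mono: "U \<subseteq> V \<Longrightarrow> mono_ideal d U \<subseteq> mono_ideal d V"
  by (auto simp: mono_ideal_def)

lemma loc_ring_simps [simp]:
  "carrier (loc_ring d) = mono_ideal d (exps d)"
  "monoid.mult (loc_ring d) = (*)" "one (loc_ring d) = 1" "ring.zero (loc_ring d) = 0" "add (loc_ring d) = (+)"
  by (auto simp: loc_ring_def mono_ideal_def denoms_eq polys_iff)

lemma loc_max_eq: "loc_max d = mono_ideal d (exps d - {0})"
proof -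
  have "f \<in> homogeneous_max d \<longleftrightarrow> Poly_Mapping.keys f \<subseteq> exps d - {0}" for f :: "'a poly_nat_vars"
    by (auto simp: homogeneous_max_def polys_iff in_keys_iff)
  then show ?thesis
    by (simp add: loc_max_def mono_ideal_def denoms_eq)
qed

text \<open>Clearing a denominator \<open>g\<close> leaves the monomial with coefficient equal to
  the constant term of \<open>g\<close>, which is nonzero. Hence membership of monomials survives
  localization, and comparing monomial ideals becomes comparing exponent sets.\<close>

lemma Fract_monom_in_mono_ideal_iff:
  "Fract (monom e :: 'k::field poly_nat_vars) 1 \<in> mono_ideal d U \<longleftrightarrow> e \<in> U"
proof
  let ?x = "Fract (monom e :: 'k poly_nat_vars) 1"
  assume "?x \<in> mono_ideal d U"
  then obtain f g where fg: "?x = Fract f g" "Poly_Mapping.keys f \<subseteq> U"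
      "g \<in> denoms d" "g \<noteq> 0"
    by (rule mono_idealE)
  then have "monom e * g = f" by (simp add: eq_fract)
  then have "Poly_Mapping.lookup f e = Poly_Mapping.lookup g 0"
    using lookup_monom_mult[of e g 0] by simp
  with fg show "e \<in> U" by (auto simp: denoms_def in_keys_iff)
qed (auto intro!: mono_idealI)

lemma mono_ideal_add:
  assumes "exps_ideal d U" "x \<in> mono_ideal d U" "y \<in> mono_ideal d U"
  shows "x + y \<in> mono_ideal d U"
proof -
  obtain f g where x: "x = Fract f g" "Poly_Mapping.keys f \<subseteq> U" "g \<in> denoms d" "g \<noteq> 0"
    using assms by (auto elim: mono_idealE)
  obtain f' g' where y: "y = Fract f' g'" "Poly_Mapping.keys f' \<subseteq> U" "g' \<in> denoms d" "g' \<noteq> 0"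
    using assms by (auto elim: mono_idealE)
  have "Poly_Mapping.keys (f * g' + f' * g) \<subseteq> U"
    using keys_mult_subset(1)[OF assms(1) x(2) denoms_polys[OF y(3)]]
      keys_mult_subset(1)[OF assms(1) y(2) denoms_polys[OF x(3)]]
    by (intro order_trans[OF Poly_Mapping.keys_add] Un_least)
  then show ?thesis using x y by (simp add: mono_idealI)
qed

lemma mono_ideal_uminus: "x \<in> mono_ideal d U \<Longrightarrow> - x \<in> mono_ideal d U"
  by (erule mono_idealE) (auto intro!: mono_idealI)

lemma mono_ideal_mult:
  assumes "\<And>a b. a \<in> U \<Longrightarrow> b \<in> V \<Longrightarrow> a + b \<in> W" "x \<in> mono_ideal d U" "y \<in> mono_ideal d V"
  shows "x * y \<in> mono_ideal d W"
proof -
  obtain f g where x: "x = Fract f g" "Poly_Mapping.keys f \<subseteq> U" "g \<in> denoms d" "g \<noteq> 0"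
    using assms by (auto elim: mono_idealE)
  obtain f' g' where y: "y = Fract f' g'" "Poly_Mapping.keys f' \<subseteq> V" "g' \<in> denoms d" "g' \<noteq> 0"
    using assms by (auto elim: mono_idealE)
  have "Poly_Mapping.keys (f * f') \<subseteq> W"
    using keys_mult[of f f'] x y assms(1) by blast
  then show ?thesis using x y by (simp add: mono_idealI)
qed

lemma mono_ideal_0 [simp]: "0 \<in> mono_ideal d U"
  using mono_idealI[of 0 U 1 d] by (simp add: fract_collapse)

lemma Fract_in_carrier: "f \<in> polys d \<Longrightarrow> Fract f 1 \<in> mono_ideal d (exps d)"
  by (intro mono_idealI) (auto simp: polys_iff)

lemma one_in_carrier [simp]: "1 \<in> mono_ideal d (exps d)"
  using Fract_in_carrier[of 1 d] by (simp add: fract_collapse)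

section \<open>Ring structure and ideals of the localization\<close>

lemma cring_loc_ring: "cring (loc_ring d)"
proof (rule cringI)
  show "abelian_group (loc_ring d)"
  proof (rule abelian_groupI)
    show "\<exists>y\<in>carrier (loc_ring d). y \<oplus>\<^bsub>loc_ring d\<^esub> x = \<zero>\<^bsub>loc_ring d\<^esub>"
      if "x \<in> carrier (loc_ring d)" for x
      using that by (intro bexI[of _ "- x"]) (auto intro: mono_ideal_uminus)
  qed (auto simp: add_ac intro: mono_ideal_add)
  show "comm_monoid (loc_ring d)"
    by (rule comm_monoidI) (auto simp: mult_ac intro: mono_ideal_mult)
qed (auto simp: algebra_simps)

lemma loc_ring_a_inv [simp]: "x \<in> mono_ideal d (exps d) \<Longrightarrow> \<ominus>\<^bsub>loc_ring d\<^esub> x = - x"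
proof -
  assume x: "x \<in> mono_ideal d (exps d)"
  interpret cring "loc_ring d" by (rule cring_loc_ring)
  show ?thesis using minus_equality[of "- x" x] x by (simp add: mono_ideal_uminus)
qed

lemma loc_ring_pow [simp]: "x [^]\<^bsub>loc_ring d\<^esub> (n::nat) = x ^ n"
proof -
  interpret cring "loc_ring d" by (rule cring_loc_ring)
  show ?thesis by (induction n) (auto simp: mult.commute)
qed

lemma ideal_loc_ringI:
  assumes "K \<subseteq> mono_ideal d (exps d)" "0 \<in> K" "\<And>x y. x \<in> K \<Longrightarrow> y \<in> K \<Longrightarrow> x + y \<in> K"
    "\<And>c x. c \<in> mono_ideal d (exps d) \<Longrightarrow> x \<in> K \<Longrightarrow> c * x \<in> K"
  shows "ideal K (loc_ring d)"
proof -
  interpret cring "loc_ring d" by (rule cring_loc_ring)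
  show ?thesis
  proof (rule idealI)
    show "subgroup K (add_monoid (loc_ring d))"
    proof (rule group.subgroupI)
      show "group (add_monoid (loc_ring d))" by (rule add.group_axioms)
      show "inv\<^bsub>add_monoid (loc_ring d)\<^esub> a \<in> K" if "a \<in> K" for a
      proof -
        have "inv\<^bsub>add_monoid (loc_ring d)\<^esub> a = - a"
          using loc_ring_a_inv[of a d] that assms(1) by (auto simp: a_inv_def)
        also have "\<dots> = (- 1) * a" by simp
        also have "\<dots> \<in> K" using that by (intro assms) (auto intro: mono_ideal_uminus)
        finally show ?thesis .
      qed
    qed (use assms in auto)
  next
    show "x \<otimes>\<^bsub>loc_ring d\<^esub> a \<in> K" if "a \<in> K" "x \<in> carrier (loc_ring d)" for a x
      using that assms(4) by simp
    then show "a \<otimes>\<^bsub>loc_ring d\<^esub> x \<in> K" if "a \<in> K" "x \<in> carrier (loc_ring d)" for a x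
      using that by (simp add: mult.commute)
  qed (rule ring_axioms)
qed

lemma ideal_loc_ringD:
  assumes "ideal K (loc_ring d)"
  shows "K \<subseteq> mono_ideal d (exps d)" "0 \<in> K" "\<And>x y. x \<in> K \<Longrightarrow> y \<in> K \<Longrightarrow> x + y \<in> K"
    "\<And>x y. x \<in> K \<Longrightarrow> y \<in> K \<Longrightarrow> x - y \<in> K"
    "\<And>c x. c \<in> mono_ideal d (exps d) \<Longrightarrow> x \<in> K \<Longrightarrow> c * x \<in> K"
    "\<And>A f. (\<And>a. a \<in> A \<Longrightarrow> f a \<in> K) \<Longrightarrow> sum f A \<in> K"
proof -
  interpret ideal K "loc_ring d" by fact
  show sub: "K \<subseteq> mono_ideal d (exps d)" using a_subset by simp
  show z: "0 \<in> K" using additive_subgroup.zero_closed[OF additive_subgroup_axioms] by simp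
  show p: "\<And>x y. x \<in> K \<Longrightarrow> y \<in> K \<Longrightarrow> x + y \<in> K" using additive_subgroup.a_closed[OF additive_subgroup_axioms] by simp
  show m: "\<And>c x. c \<in> mono_ideal d (exps d) \<Longrightarrow> x \<in> K \<Longrightarrow> c * x \<in> K"
    using I_l_closed by simp
  show "x - y \<in> K" if "x \<in> K" "y \<in> K" for x y
    using p[OF that(1) m[OF mono_ideal_uminus[OF one_in_carrier] that(2)]] by simp
  show "\<And>A f. (\<And>a. a \<in> A \<Longrightarrow> f a \<in> K) \<Longrightarrow> sum f A \<in> K"
    subgoal for A f by (induction A rule: infinite_finite_induct) (auto simp: z p) done
qed

lemma ideal_mono_ideal:
  assumes "exps_ideal d U"
  shows "ideal (mono_ideal d U) (loc_ring d)"
proof (rule ideal_loc_ringI)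
  show "mono_ideal d U \<subseteq> mono_ideal d (exps d)"
    using assms by (intro mono_ideal_mono exps_ideal_subset)
qed (use assms in \<open>auto intro: mono_ideal_add mono_ideal_mult dest: exps_idealD\<close>)

lemma Fract_sum: "Fract (sum f A :: 'b::idom) 1 = (\<Sum>a\<in>A. Fract (f a) 1)"
proof -
  have add: "Fract (a + b) 1 = Fract a 1 + Fract b 1" for a b :: 'b
    by simp
  show ?thesis
  proof (induction A rule: infinite_finite_induct)
    case (insert x F)
    show ?case unfolding sum.insert[OF insert(1,2)] add insert(3) by (rule refl)
  qed (simp_all add: fract_collapse)
qed

text \<open>A numerator is a combination of its monomials with constant coefficients, and the
  inverse of a denominator lies in the ring. Inclusions of a monomial ideal in another ideal thus
  need checking on monomials only.\<close>

lemma mono_ideal_least: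
  fixes K :: "'k::field poly_nat_vars fract set"
  assumes K: "ideal K (loc_ring d)" and mon: "\<And>e. e \<in> U \<Longrightarrow> Fract (monom e) 1 \<in> K"
  shows "mono_ideal d U \<subseteq> K"
proof
  fix x :: "'k poly_nat_vars fract" assume "x \<in> mono_ideal d U"
  then obtain f g where x: "x = Fract f g" "Poly_Mapping.keys f \<subseteq> U" "g \<in> denoms d" "g \<noteq> 0"
    by (rule mono_idealE)
  have "x = Fract 1 g * Fract f 1" using x by simp
  also have "Fract f 1 = (\<Sum>e\<in>Poly_Mapping.keys f.
      Fract (const (Poly_Mapping.lookup f e)) 1 * Fract (monom e) 1)"
    by (subst poly_eq_sum_monom[of f]) (simp add: Fract_sum)
  also have "Fract 1 g * \<dots> \<in> K"
    using x mon
    by (intro ideal_loc_ringD(5)[OF K] ideal_loc_ringD(6)[OF K] Fract_in_carrier mono_idealI) auto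
  finally show "x \<in> K" .
qed

lemma mono_ideal_strict_mono: "U \<subset> V \<Longrightarrow> mono_ideal d U \<subset> mono_ideal d V"
  using mono_ideal_mono[of U V d] Fract_monom_in_mono_ideal_iff[of _ d U]
    Fract_monom_in_mono_ideal_iff[of _ d V] by blast

section \<open>Total degree, and building exponent vectors from functions\<close>

definition edeg :: "nat \<Rightarrow> (nat \<Rightarrow>\<^sub>0 nat) \<Rightarrow> nat" where
  "edeg d e = (\<Sum>i<d. Poly_Mapping.lookup e i)"

lemma edeg_add: "edeg d (a + b) = edeg d a + edeg d b"
  by (simp add: edeg_def lookup_add sum.distrib)

lemma edeg_eq_0_iff: "e \<in> exps d \<Longrightarrow> edeg d e = 0 \<longleftrightarrow> e = 0"
  by (auto simp: edeg_def intro!: poly_mapping_eqI)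
    (metis exps_lookup lessThan_iff not_le)

lemma edeg_0 [simp]: "edeg d 0 = 0"
  by (simp add: edeg_def)

lemma edeg_single [simp]: "i < d \<Longrightarrow> edeg d (Poly_Mapping.single i n) = n"
  by (simp add: edeg_def lookup_single when_def)

lemma exps_eqI:
  assumes "a \<in> exps d" "b \<in> exps d" "\<And>i. i < d \<Longrightarrow> Poly_Mapping.lookup a i = Poly_Mapping.lookup b i"
  shows "a = b"
  by (rule poly_mapping_eqI) (metis assms exps_lookup not_le)

definition exp_of :: "nat \<Rightarrow> (nat \<Rightarrow> nat) \<Rightarrow> nat \<Rightarrow>\<^sub>0 nat" where
  "exp_of d f = Abs_poly_mapping (\<lambda>i. if i < d then f i else 0)"

lemma lookup_exp_of [simp]: "Poly_Mapping.lookup (exp_of d f) i = (if i < d then f i else 0)"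
proof -
  have "finite {i. (if i < d then f i else 0) \<noteq> 0}"
    by (rule finite_subset[of _ "{..<d}"]) (auto split: if_splits)
  then show ?thesis unfolding exp_of_def by simp
qed

lemma exp_of_exps [simp]: "exp_of d f \<in> exps d"
  by (auto simp: exps_def in_keys_iff split: if_splits)

section \<open>Lengths of quotients by monomial ideals\<close>

text \<open>A numerator with nonzero constant term is itself an admissible denominator, so the
  fraction can be inverted. This is the source of locality.\<close>

lemma loc_ring_unit:
  assumes "x \<in> mono_ideal d (exps d)" "x \<notin> mono_ideal d (exps d - {0})"
  obtains y where "y \<in> mono_ideal d (exps d)" "x * y = 1"
proof -
  obtain f g where x: "x = Fract f g" "Poly_Mapping.keys f \<subseteq> exps d" "g \<in> denoms d" "g \<noteq> 0"
    using assms(1) by (rule mono_idealE)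
  have "\<not> Poly_Mapping.keys f \<subseteq> exps d - {0}"
    using assms(2) x by (auto intro: mono_idealI)
  then have f: "f \<in> denoms d" using x by (auto simp: denoms_def polys_iff in_keys_iff)
  have "Fract g f \<in> mono_ideal d (exps d)"
    using denoms_polys[OF x(3)] f by (auto simp: polys_iff intro: mono_idealI)
  moreover have "x * Fract g f = 1"
    using x denoms_nonzero[OF f] by (simp add: One_fract_def eq_fract)
  ultimately show ?thesis using that by blast
qed

text \<open>Fill the complement from the top degree down: adding a nonzero vector to a missing
  exponent of maximal degree raises the degree, so the sum already lies in \<open>U\<close>, and
  inserting that exponent preserves closure.\<close>

lemma exps_ideal_chain:
  assumes "exps_ideal d U" "finite (exps d - U)" "card (exps d - U) = N"
  shows "\<exists>V. V 0 = U \<and> V N = exps d \<and> (\<forall>i\<le>N. exps_ideal d (V i)) \<and>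
     (\<forall>i<N. \<exists>e\<in>exps d - V i. V (Suc i) = insert e (V i))"
  using assms
proof (induction N arbitrary: U)
  case 0
  then have "U = exps d" using exps_ideal_subset[of d U] by auto
  then show ?case by (intro exI[of _ "\<lambda>_. U"]) auto
next
  case (Suc N)
  let ?C = "exps d - U"
  have "Max (edeg d ` ?C) \<in> edeg d ` ?C" using Suc.prems by (intro Max_in) force+
  then obtain e where e: "e \<in> ?C" "edeg d e = Max (edeg d ` ?C)" by auto
  have max: "edeg d a \<le> edeg d e" if "a \<in> ?C" for a using that Suc.prems e by auto
  have "exps_ideal d (insert e U)"
  proof (rule exps_idealI)
    fix a b assume a: "a \<in> exps d" and b: "b \<in> insert e U"
    show "a + b \<in> insert e U"
    proof (cases "b = e \<and> a \<noteq> 0")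
      case True
      then have "edeg d (a + e) > edeg d e"
        using edeg_eq_0_iff[OF a] by (simp add: edeg_add)
      then show ?thesis using max[of "a + e"] a e True by fastforce
    next
      case False
      then show ?thesis using a b exps_idealD[OF Suc.prems(1) _ a] by auto
    qed
  qed (use e exps_ideal_subset[OF Suc.prems(1)] in auto)
  moreover have "exps d - insert e U = ?C - {e}" by auto
  moreover have "card (?C - {e}) = N" using Suc.prems e by simp
  ultimately obtain V where V: "V 0 = insert e U" "V N = exps d" "\<forall>i\<le>N. exps_ideal d (V i)"
     "\<forall>i<N. \<exists>e\<in>exps d - V i. V (Suc i) = insert e (V i)"
    using Suc.IH[of "insert e U"] Suc.prems by auto
  define W where "W i = (case i of 0 \<Rightarrow> U | Suc j \<Rightarrow> V j)" for i
  have "W 0 = U" "W (Suc N) = exps d" by (auto simp: W_def V)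
  moreover have "\<forall>i\<le>Suc N. exps_ideal d (W i)"
    using V Suc.prems by (auto simp: W_def split: nat.split)
  moreover have "\<exists>e\<in>exps d - W i. W (Suc i) = insert e (W i)" if "i < Suc N" for i
    using that V(1,4) e by (cases i) (auto simp: W_def)
  ultimately show ?case by blast
qed

lemma lookup_const_mult: "Poly_Mapping.lookup (const c * g) a = c * Poly_Mapping.lookup g a"
proof -
  have "Poly_Mapping.lookup (const c * g) a =
      (\<Sum>l. c * (\<Sum>q. Poly_Mapping.lookup g q when a = l + q) when l = 0)"
    by (simp only: lookup_mult const_def lookup_single when_mult eq_commute[of 0])
  then show ?thesis by (simp add: eq_commute[of a])
qed

text \<open>Modulo the smaller ideal only the coefficient at \<open>e\<close> matters, so the layer
  is one-dimensional over the residue field and any nonzero element generates it.\<close>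

lemma mono_ideal_insert_simple:
  fixes x y :: "'k::field poly_nat_vars fract"
  assumes y: "y \<in> mono_ideal d (insert e U)" "y \<notin> mono_ideal d U"
    and x: "x \<in> mono_ideal d (insert e U)"
  obtains c where "c \<in> mono_ideal d (exps d)" "x - c * y \<in> mono_ideal d U"
proof -
  obtain f g where fg: "y = Fract f g" "Poly_Mapping.keys f \<subseteq> insert e U" "g \<in> denoms d" "g \<noteq> 0"
    using y(1) by (rule mono_idealE)
  obtain f' g' where fg': "x = Fract f' g'" "Poly_Mapping.keys f' \<subseteq> insert e U"
      "g' \<in> denoms d" "g' \<noteq> 0"
    using x by (rule mono_idealE)
  have "\<not> Poly_Mapping.keys f \<subseteq> U" using y(2) fg by (auto intro: mono_idealI)
  then have "Poly_Mapping.lookup f e \<noteq> 0" using fg by (auto simp: in_keys_iff)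
  \<comment> \<open>The ratio that cancels the coefficient at \<open>e\<close> in the numerator of
    \<open>x\<close>; the multiplier of \<open>y\<close> is then \<open>r\<close> times
    \<open>g / g'\<close>, which also exchanges the denominators.\<close>
  define r where "r = Poly_Mapping.lookup f' e / Poly_Mapping.lookup f e"
  let ?h = "f' - const r * f"
  have lk: "Poly_Mapping.lookup ?h a = Poly_Mapping.lookup f' a - r * Poly_Mapping.lookup f a" for a
    by (simp add: lookup_minus lookup_const_mult)
  have "Poly_Mapping.lookup ?h e = 0"
    unfolding lk using \<open>Poly_Mapping.lookup f e \<noteq> 0\<close> by (simp add: r_def)
  moreover have "Poly_Mapping.lookup ?h a = 0" if "a \<notin> insert e U" for a
  proof -
    have "Poly_Mapping.lookup f a = 0" "Poly_Mapping.lookup f' a = 0"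
      using that fg(2) fg'(2) by (auto simp: in_keys_iff)
    then show ?thesis by (simp add: lk)
  qed
  ultimately have "Poly_Mapping.lookup ?h a = 0" if "a \<notin> U" for a
    using that by (cases "a = e") blast+
  then have h: "Poly_Mapping.keys ?h \<subseteq> U" by (meson in_keys_iff subsetI)
  have "Fract (const r * g) g' * y = Fract (const r * f) g'"
    using fg fg' by (simp add: eq_fract)
  then have "x - Fract (const r * g) g' * y = Fract ?h g'"
    using fg' by (simp add: eq_fract algebra_simps)
  then have "x - Fract (const r * g) g' * y \<in> mono_ideal d U"
    using h fg' by (simp add: mono_idealI)
  moreover have "Fract (const r * g) g' \<in> mono_ideal d (exps d)"
    using polys_mult[OF polys_intros(3) denoms_polys[OF fg(3)]] fg'(3)
    by (intro mono_idealI) (auto simp: polys_iff)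
  ultimately show ?thesis using that by blast
qed

text \<open>The chain of exponent sets yields a composition series gaining one monomial at each
  step, so the length counts the monomials outside the ideal.\<close>

lemma module_length_mono_ideal:
  assumes U: "exps_ideal d U" "finite (exps d - U)"
  shows "module_length (loc_ring d :: 'k::field poly_nat_vars fract ring)
      (quot_module (loc_ring d) (mono_ideal d U)) = enat (card (exps d - U))"
proof -
  define N where "N = card (exps d - U)"
  obtain V where V: "V 0 = U" "V N = exps d" "\<And>i. i \<le> N \<Longrightarrow> exps_ideal d (V i)"
     "\<And>i. i < N \<Longrightarrow> \<exists>e\<in>exps d - V i. V (Suc i) = insert e (V i)"
    using exps_ideal_chain[OF U, of N] by (auto simp: N_def)
  interpret R: cring "loc_ring d :: 'k poly_nat_vars fract ring" by (rule cring_loc_ring)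
  have "module_length (loc_ring d :: 'k poly_nat_vars fract ring)
      (quot_module (loc_ring d) (mono_ideal d (V 0))) = enat N"
  proof (rule module_length_quot_module)
    show "mono_ideal d (V i) \<subset> (mono_ideal d (V (Suc i)) :: 'k poly_nat_vars fract set)" if "i < N" for i
      using V(4)[OF that] by (intro mono_ideal_strict_mono) auto
    fix i and x y :: "'k poly_nat_vars fract"
    assume i: "i < N" and y: "y \<in> mono_ideal d (V (Suc i)) - mono_ideal d (V i)"
      and x: "x \<in> mono_ideal d (V (Suc i))"
    obtain e where "V (Suc i) = insert e (V i)" using V(4)[OF i] by blast
    then obtain c where c: "c \<in> mono_ideal d (exps d)" "x - c * y \<in> mono_ideal d (V i)"
      using x y by (metis DiffE mono_ideal_insert_simple)
    have "y \<in> mono_ideal d (exps d)"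
      using y mono_ideal_mono[OF exps_ideal_subset[OF V(3)[of "Suc i"]]] i by auto
    then have "c * y \<in> mono_ideal d (exps d)"
      using c R.m_closed[of c y] by simp
    then show "\<exists>c\<in>carrier (loc_ring d). x \<ominus>\<^bsub>loc_ring d\<^esub> c \<otimes>\<^bsub>loc_ring d\<^esub> y \<in> mono_ideal d (V i)"
      using c by (intro bexI[of _ c]) (auto simp: a_minus_def)
  qed (use V in \<open>auto intro: ideal_mono_ideal cring_loc_ring\<close>)
  then show ?thesis by (simp add: V N_def)
qed

section \<open>Ordinary and Frobenius powers\<close>

definition exps_ge :: "nat \<Rightarrow> nat \<Rightarrow> (nat \<Rightarrow>\<^sub>0 nat) set" where
  "exps_ge d t = {e \<in> exps d. t \<le> edeg d e}"

definition exps_frob :: "nat \<Rightarrow> nat \<Rightarrow> nat \<Rightarrow> (nat \<Rightarrow>\<^sub>0 nat) set" where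
  "exps_frob d q t = {e \<in> exps d. t \<le> (\<Sum>i<d. Poly_Mapping.lookup e i div q)}"

lemma exps_ideal_exps_ge [simp]: "exps_ideal d (exps_ge d t)"
  by (rule exps_idealI) (auto simp: exps_ge_def edeg_add)

lemma exps_ideal_exps_frob [simp]: "exps_ideal d (exps_frob d q t)"
proof (rule exps_idealI)
  fix a e assume "a \<in> exps d" and e: "e \<in> exps_frob d q t"
  have "(\<Sum>i<d. Poly_Mapping.lookup e i div q) \<le> (\<Sum>i<d. Poly_Mapping.lookup (a + e) i div q)"
    by (intro sum_mono div_le_mono) (simp add: lookup_add)
  then show "a + e \<in> exps_frob d q t"
    using \<open>a \<in> exps d\<close> e by (simp add: exps_frob_def)
qed (simp add: exps_frob_def)

lemma exps_ge_1: "exps_ge d 1 = exps d - {0}"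
  using edeg_eq_0_iff by (fastforce simp: exps_ge_def)

text \<open>Splitting off one variable drives the induction on powers of the maximal ideal and shows
  that the variables generate it.\<close>

lemma monom_var_factor:
  assumes "e \<in> exps_ge d (Suc t)"
  obtains a i where "i < d" "a \<in> exps_ge d t" "e = a + Poly_Mapping.single i 1"
proof -
  have "edeg d e \<noteq> 0" using assms by (simp add: exps_ge_def)
  then obtain i where i: "i < d" "Poly_Mapping.lookup e i \<noteq> 0"
    by (auto simp: edeg_def)
  \<comment> \<open>Subtraction of exponent vectors truncates at zero; it is exact here because
    coordinate \<open>i\<close> is positive.\<close>
  have eq: "e = (e - Poly_Mapping.single i 1) + Poly_Mapping.single i 1"
    using i by (intro poly_mapping_eqI) (auto simp: lookup_add lookup_minus lookup_single when_def)
  have e: "e \<in> exps d" "Suc t \<le> edeg d e" using assms by (auto simp: exps_ge_def)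
  have "e - Poly_Mapping.single i 1 \<in> exps d" using e(1) by (subst (asm) eq) simp
  moreover have "edeg d e = edeg d (e - Poly_Mapping.single i 1) + 1"
    by (subst eq) (simp only: edeg_add edeg_single[OF i(1)])
  ultimately have "e - Poly_Mapping.single i 1 \<in> exps_ge d t"
    using e by (simp add: exps_ge_def)
  then show ?thesis using that i eq by blast
qed

lemma loc_max_mono_ideal: "loc_max d = mono_ideal d (exps_ge d 1)"
  by (simp only: loc_max_eq exps_ge_1)

lemma loc_var_eq: "loc_var i = Fract (monom (Poly_Mapping.single i 1)) 1"
  by (simp add: loc_var_def monom_def)

text \<open>Degrees add under multiplication, which gives one inclusion of the induction step; for
  the other, a monomial of degree at least t + 1 is a variable times one of degree at least
  t.\<close>

lemma ideal_power_loc_max: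
  "ideal_power (loc_ring d) (loc_max d) t =
    (mono_ideal d (exps_ge d t) :: 'k::field poly_nat_vars fract set)"
proof (induction t)
  case 0
  have "exps_ge d 0 = exps d" by (simp add: exps_ge_def)
  then show ?case by (simp add: ideals_set_def)
next
  case (Suc t)
  let ?R = "loc_ring d :: 'k poly_nat_vars fract ring"
  let ?P = "ideal_prod ?R (mono_ideal d (exps_ge d t)) (mono_ideal d (exps_ge d 1))"
  interpret R: cring ?R by (rule cring_loc_ring)
  have "ideal ?P ?R" by (intro R.ideal_prod_is_ideal ideal_mono_ideal) simp_all
  moreover have "Fract (monom e) 1 \<in> ?P" if e: "e \<in> exps_ge d (Suc t)" for e
  proof -
    obtain a i where a: "i < d" "a \<in> exps_ge d t" "e = a + Poly_Mapping.single i 1"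
      using e by (rule monom_var_factor)
    have "Fract (monom a) 1 \<otimes>\<^bsub>?R\<^esub> Fract (monom (Poly_Mapping.single i 1)) 1 \<in> ?P"
      using a by (intro ideal_prod.prod)
        (auto simp: Fract_monom_in_mono_ideal_iff exps_ge_def)
    then show ?thesis by (simp add: a monom_mult)
  qed
  ultimately have "mono_ideal d (exps_ge d (Suc t)) \<subseteq> ?P" by (rule mono_ideal_least)
  moreover have "x \<in> mono_ideal d (exps_ge d (Suc t))" if "x \<in> ?P" for x
    using that
  proof (induction rule: ideal_prod.induct)
    case (prod i j)
    have "a + b \<in> exps_ge d (Suc t)" if "a \<in> exps_ge d t" "b \<in> exps_ge d 1" for a b
      using that by (auto simp: exps_ge_def edeg_add)
    from mono_ideal_mult[OF this prod] show ?case by simp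
  next
    case (sum x y)
    then show ?case by (simp add: mono_ideal_add)
  qed
  ultimately have "?P = mono_ideal d (exps_ge d (Suc t))" by blast
  moreover have "ideal_power ?R (loc_max d) (Suc t) = ?P"
    unfolding nat_pow_Suc Suc.IH by (simp add: ideals_set_def loc_max_mono_ideal)
  ultimately show ?case by simp
qed

section \<open>Frobenius powers in characteristic p\<close>

lemma CHAR_poly_nat_vars: "CHAR('k::field poly_nat_vars) = CHAR('k)"
proof (rule CHAR_eqI)
  have "of_nat n = (0 :: 'k poly_nat_vars) \<longleftrightarrow> of_nat n = (0 :: 'k)" for n
    unfolding single_of_nat [symmetric] by (metis lookup_single_eq lookup_zero single_zero)
  then show "of_nat CHAR('k) = (0 :: 'k poly_nat_vars)"
    and "\<And>n. of_nat n = (0 :: 'k poly_nat_vars) \<Longrightarrow> CHAR('k) dvd n"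
    by (auto simp: of_nat_eq_0_iff_char_dvd)
qed

text \<open>The sum of \<open>n\<close> copies of \<open>a\<close> stands for the scalar multiple of
  the exponent vector.\<close>

lemma monom_power: "monom a ^ n = monom (\<Sum>j<n. a)"
  by (induction n) (simp_all add: monom_mult add.commute del: sum_constant)

lemma Fract_power: "Fract a b ^ n = Fract (a ^ n) (b ^ n)"
  by (induction n) (simp_all add: One_fract_def)

text \<open>Additivity of the q-th power map reduces q-th powers of arbitrary elements to those of
  monomials. Conversely, dividing each exponent by q with remainder writes a monomial as a multiple
  of a q-th power.\<close>

lemma frobenius_power_mono_ideal:
  assumes p: "Factorial_Ring.prime CHAR('k::field)" and q: "q = CHAR('k) ^ n"
  shows "frobenius_power (loc_ring d) (mono_ideal d (exps_ge d t)) q =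
    (mono_ideal d (exps_frob d q t) :: 'k poly_nat_vars fract set)"
proof -
  let ?R = "loc_ring d :: 'k poly_nat_vars fract ring"
  interpret R: cring ?R by (rule cring_loc_ring)
  have "q > 0" using p q by (simp add: prime_gt_0_nat)
  define F where "F = {x [^]\<^bsub>?R\<^esub> q | x. x \<in> mono_ideal d (exps_ge d t)}"
  have scale: "(\<Sum>j<q. a) \<in> exps d \<longleftrightarrow> a \<in> exps d"
      "Poly_Mapping.lookup (\<Sum>j<q. a) i = q * Poly_Mapping.lookup a i" for a :: "nat \<Rightarrow>\<^sub>0 nat" and i
  proof -
    show lk: "Poly_Mapping.lookup (\<Sum>j<q. a) i = q * Poly_Mapping.lookup a i" for i
      unfolding lookup_sum by simp
    have "Poly_Mapping.keys (\<Sum>j<q. a) = Poly_Mapping.keys a"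
      using \<open>q > 0\<close> unfolding set_eq_iff in_keys_iff lk by simp
    then show "(\<Sum>j<q. a) \<in> exps d \<longleftrightarrow> a \<in> exps d" unfolding exps_def by simp
  qed
  have "F \<subseteq> mono_ideal d (exps_frob d q t)"
  proof
    fix y assume "y \<in> F"
    then obtain x where x: "x \<in> mono_ideal d (exps_ge d t)" "y = x ^ q" by (auto simp: F_def)
    then obtain f g where fg: "x = Fract f g" "Poly_Mapping.keys f \<subseteq> exps_ge d t"
        "g \<in> denoms d" "g \<noteq> 0"
      by (blast elim: mono_idealE)
    \<comment> \<open>The freshman's dream: no mixed terms appear, so the support of
      \<open>f ^ q\<close> is controlled by the q-fold multiples of the exponents of
      \<open>f\<close>.\<close>
    have "f ^ q = (\<Sum>e\<in>Poly_Mapping.keys f. (const (Poly_Mapping.lookup f e) * monom e) ^ q)"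
      by (subst poly_eq_sum_monom[of f], rule freshmans_dream_sum'[where n = n])
        (use p q in \<open>simp_all add: CHAR_poly_nat_vars\<close>)
    also have "Poly_Mapping.keys \<dots> \<subseteq> exps_frob d q t"
    proof (rule order_trans[OF keys_sum], rule UN_least)
      fix e assume "e \<in> Poly_Mapping.keys f"
      then have "(\<Sum>j<q. e) \<in> exps_frob d q t"
        using fg(2) \<open>q > 0\<close> by (auto simp: exps_frob_def exps_ge_def scale edeg_def simp del: sum_constant)
      then show "Poly_Mapping.keys ((const (Poly_Mapping.lookup f e) * monom e) ^ q) \<subseteq> exps_frob d q t"
        unfolding power_mult_distrib monom_power
        by (intro keys_mult_subset(2)[OF exps_ideal_exps_frob]) (simp_all del: sum_constant)
    qed
    finally show "y \<in> mono_ideal d (exps_frob d q t)"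
      using fg x by (simp add: Fract_power mono_idealI)
  qed
  then have "Idl\<^bsub>?R\<^esub> F \<subseteq> mono_ideal d (exps_frob d q t)"
    by (intro R.genideal_minimal ideal_mono_ideal) auto
  moreover have "mono_ideal d (exps_frob d q t) \<subseteq> Idl\<^bsub>?R\<^esub> F"
  proof (rule mono_ideal_least)
    have "F \<subseteq> carrier ?R"
      using order_trans[OF \<open>F \<subseteq> _\<close> mono_ideal_mono[OF exps_ideal_subset[OF exps_ideal_exps_frob]]]
      by simp
    then show I: "ideal (Idl\<^bsub>?R\<^esub> F) ?R" by (rule R.genideal_ideal)
    fix e assume e: "e \<in> exps_frob d q t"
    define a where "a = exp_of d (\<lambda>i. Poly_Mapping.lookup e i div q)"
    define b where "b = exp_of d (\<lambda>i. Poly_Mapping.lookup e i mod q)"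
    have a: "a \<in> exps d" "\<And>i. i < d \<Longrightarrow> Poly_Mapping.lookup a i = Poly_Mapping.lookup e i div q"
      and b: "b \<in> exps d" "\<And>i. i < d \<Longrightarrow> Poly_Mapping.lookup b i = Poly_Mapping.lookup e i mod q"
      by (simp_all add: a_def b_def)
    have eq: "e = b + (\<Sum>j<q. a)"
      using e a b by (intro exps_eqI[of _ d]) (auto simp: exps_frob_def scale lookup_add simp del: sum_constant)
    have "a \<in> exps_ge d t" using e a by (simp add: exps_frob_def exps_ge_def edeg_def)
    then have "Fract (monom a) 1 ^ q \<in> F"
      by (auto simp: F_def Fract_monom_in_mono_ideal_iff)
    then have "Fract (monom a) 1 ^ q \<in> Idl\<^bsub>?R\<^esub> F" using R.genideal_self[OF \<open>F \<subseteq> carrier ?R\<close>] by blast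
    then have "Fract (monom b) 1 * Fract (monom a) 1 ^ q \<in> Idl\<^bsub>?R\<^esub> F"
      by (intro ideal_loc_ringD(5)[OF I]) (simp_all add: Fract_monom_in_mono_ideal_iff b)
    then show "Fract (monom e) 1 \<in> Idl\<^bsub>?R\<^esub> F"
      by (simp add: eq Fract_power monom_power monom_mult del: sum_constant)
  qed
  ultimately show ?thesis by (simp add: frobenius_power_def F_def)
qed

section \<open>The residue field\<close>

text \<open>This makes the normalizing power of p trivial in the Hilbert-Kunz multiplicity of the
  residue field.\<close>

lemma (in field) krull_dim_field: "krull_dim R = enat 0"
  unfolding krull_dim_def
proof (rule chain_sup_eqI)
  show "primeideal {\<zero>} R" by (rule zeroprimeideal)
  have prime: "P = {\<zero>}" if "primeideal P R" for P
  proof -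
    interpret primeideal P R by fact
    have "P \<in> {I. ideal I R}" using is_ideal by simp
    then show ?thesis using I_notcarr unfolding all_ideals by auto
  qed
  fix n :: nat and C
  assume C: "\<And>i. i \<le> n \<Longrightarrow> primeideal (C i) R" "\<And>i. i < n \<Longrightarrow> C i \<subset> C (Suc i)"
  show "n \<le> 0"
  proof (rule ccontr)
    assume "\<not> n \<le> 0"
    then show False using C(2)[of 0] prime[OF C(1)[of 0]] prime[OF C(1)[of 1]] by auto
  qed
qed simp

text \<open>Frobenius powers of zero are zero and a field has length one over itself, so the
  defining sequence is constant.\<close>

lemma (in field) e_HK_zero_ideal:
  assumes "p > 0"
  shows "e_HK p R {\<zero>} = 1"
proof -
  have "{x [^] q | x. x \<in> {\<zero>}} = {\<zero>}" if "q > 0" for q :: nat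
    using that by (auto simp: nat_pow_zero)
  then have frob: "frobenius_power R {\<zero>} (p ^ n) = {\<zero>}" for n
    using assms by (simp add: frobenius_power_def genideal_zero)
  define K where "K i = (if i = 0 then {\<zero>} else carrier R)" for i :: nat
  have "module_length R (quot_module R (K 0)) = enat 1"
  proof (rule module_length_quot_module)
    show "ideal (K i) R" for i by (auto simp: K_def zeroideal oneideal)
    show "K i \<subset> K (Suc i)" if "i < 1" for i
    proof -
      have "\<one> \<in> carrier R - {\<zero>}" using one_not_zero by simp
      then have "{\<zero>} \<subset> carrier R" using zero_closed by blast
      then show ?thesis using that by (simp add: K_def)
    qed
    fix i x y assume "i < (1::nat)" "y \<in> K (Suc i) - K i" "x \<in> K (Suc i)"
    then have xy: "i = 0" "y \<in> carrier R" "y \<noteq> \<zero>" "x \<in> carrier R" by (auto simp: K_def)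
    then have u: "y \<in> Units R" by (simp add: field_Units)
    then have "x \<ominus> (x \<otimes> inv y) \<otimes> y = \<zero>"
      using xy by (simp add: m_assoc Units_l_inv a_minus_def r_neg)
    then show "\<exists>c\<in>carrier R. x \<ominus> c \<otimes> y \<in> K i"
      using xy u by (intro bexI[of _ "x \<otimes> inv y"]) (auto simp: K_def)
  qed (auto simp: K_def is_cring)
  then have "module_length R (quot_module R {\<zero>}) = enat 1" by (simp add: K_def)
  then show ?thesis by (simp add: e_HK_def frob krull_dim_field)
qed

lemma quot_extension_eq_zero:
  assumes "ideal I A" "J \<subseteq> I" "J \<noteq> {}"
  shows "quot_extension A I J = {\<zero>\<^bsub>A Quot I\<^esub>}"
proof -
  interpret ideal I A by fact
  have "I +>\<^bsub>A\<^esub> a = \<zero>\<^bsub>A Quot I\<^esub>" if "a \<in> J" for a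
    using a_rcos_const that assms(2) by (simp add: FactRing_def subset_iff)
  then have "(\<lambda>a. I +>\<^bsub>A\<^esub> a) ` J = {\<zero>\<^bsub>A Quot I\<^esub>}"
    using assms(3) by (simp add: image_constant_conv cong: image_cong)
  then show ?thesis
    using ring.genideal_zero[OF quotient_is_ring] by (simp add: quot_extension_def)
qed

section \<open>Binomial coefficients\<close>

text \<open>Peel off one factor: \<open>n choose d\<close> is \<open>n / d\<close> times
  \<open>m choose k\<close> for the predecessors, and \<open>m / k\<close> exceeds
  \<open>n / d\<close> because \<open>n > d\<close>. Since \<open>k\<close> is positive, this stays
  strict after raising to the power \<open>k\<close>.\<close>

lemma binomial_gt_power:
  assumes "2 \<le> d" "d < n"
  shows "(real n / real d) ^ d < real (n choose d)"
proof -
  obtain k m where km: "d = Suc k" "n = Suc m" "0 < k" "k < m"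
    using assms by (metis Suc_le_D Suc_less_eq2 Suc_le_lessD numeral_2_eq_2 Suc_le_mono)
  have "(real n / real d) ^ k < (real m / real k) ^ k"
    using km by (intro power_strict_mono) (simp_all add: field_simps)
  also have "\<dots> \<le> real (m choose k)"
    using binomial_ge_n_over_k_pow_k[of k m, where ?'a = real] km by simp
  finally have "(real n / real d) ^ d < real n / real d * real (m choose k)"
    using km mult_strict_left_mono[of "(real n / real d) ^ k" _ "real n / real d"] by simp
  also have "\<dots> = real (n choose d)"
  proof -
    have "real d * real (n choose d) = real n * real (m choose k)"
      using Suc_times_binomial[of k m] unfolding km(1,2) by (metis of_nat_mult)
    then show ?thesis using assms by (simp add: field_simps)
  qed
  finally show ?thesis .
qed

text \<open>Prepending the slack \<open>m - sum_list l\<close> turns the inequality into an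
  equation, which stars and bars counts.\<close>

lemma card_lists_sum_le: "card {l :: nat list. length l = d \<and> sum_list l \<le> m} = (m + d) choose d"
proof -
  have "bij_betw (\<lambda>l. (m - sum_list l) # l) {l :: nat list. length l = d \<and> sum_list l \<le> m}
      {l. length l = Suc d \<and> sum_list l = m}"
  proof (rule bij_betw_imageI)
    show "inj_on (\<lambda>l. (m - sum_list l) # l) {l. length l = d \<and> sum_list l \<le> m}"
      by (rule inj_onI) simp
    have "l \<in> (\<lambda>l. (m - sum_list l) # l) ` {l. length l = d \<and> sum_list l \<le> m}"
      if "length l = Suc d" "sum_list l = m" for l
    proof (rule image_eqI)
      show "l = (m - sum_list (tl l)) # tl l" "tl l \<in> {l. length l = d \<and> sum_list l \<le> m}"
        using that by (cases l; simp)+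
    qed
    then show "(\<lambda>l. (m - sum_list l) # l) ` {l. length l = d \<and> sum_list l \<le> m} =
        {l. length l = Suc d \<and> sum_list l = m}"
      by auto
  qed
  then have "card {l :: nat list. length l = d \<and> sum_list l \<le> m} =
      card {l :: nat list. length l = Suc d \<and> sum_list l = m}"
    by (rule bij_betw_same_card)
  also have "\<dots> = (m + d) choose m" by (simp add: card_length_sum_list)
  also have "\<dots> = (m + d) choose d" by (metis add_diff_cancel_left' binomial_symmetric le_add1)
  finally show ?thesis .
qed

lemma finite_lists_sum_le: "finite {l :: nat list. length l = d \<and> sum_list l \<le> m}"
  by (rule finite_subset[OF _ finite_lists_length_eq[of "{..m}" d]])
    (auto intro: order_trans[OF member_le_sum_list])

section \<open>Invariants of the powers of the maximal ideal\<close>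

lemma mono_ideal_subset_iff:
  "(mono_ideal d U :: 'k::field poly_nat_vars fract set) \<subseteq> mono_ideal d V \<longleftrightarrow> U \<subseteq> V"
  using mono_ideal_mono[of U V d, where ?'a = 'k]
    Fract_monom_in_mono_ideal_iff[of _ d U, where ?'k = 'k]
    Fract_monom_in_mono_ideal_iff[of _ d V, where ?'k = 'k] by blast

text \<open>Coordinates identify these exponents with lists of sum at most \<open>t - 1\<close>. For
  \<open>t = 0\<close> the truncated predecessor would give the value 1 instead of 0.\<close>

lemma exps_diff_exps_ge:
  assumes "t > 0"
  shows "finite (exps d - exps_ge d t)" "card (exps d - exps_ge d t) = (t - 1 + d) choose d"
proof -
  have "bij_betw (\<lambda>e. map (Poly_Mapping.lookup e) [0..<d]) (exps d - exps_ge d t)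
      {l. length l = d \<and> sum_list l \<le> t - 1}"
  proof (rule bij_betw_imageI)
    show "inj_on (\<lambda>e. map (Poly_Mapping.lookup e) [0..<d]) (exps d - exps_ge d t)"
      by (rule inj_onI, rule exps_eqI[of _ d]) auto
    have deg: "sum_list (map (Poly_Mapping.lookup e) [0..<d]) = edeg d e" for e
      by (simp add: edeg_def interv_sum_list_conv_sum_set_nat lessThan_atLeast0)
    have lt: "edeg d e \<le> t - 1 \<longleftrightarrow> \<not> t \<le> edeg d e" for e using assms by auto
    have "l \<in> (\<lambda>e. map (Poly_Mapping.lookup e) [0..<d]) ` (exps d - exps_ge d t)"
      if l: "length l = d" "sum_list l \<le> t - 1" for l
    proof (rule image_eqI)
      show eq: "l = map (Poly_Mapping.lookup (exp_of d ((!) l))) [0..<d]"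
        using l by (intro nth_equalityI) auto
      show "exp_of d ((!) l) \<in> exps d - exps_ge d t"
        using l lt deg[of "exp_of d ((!) l)"] unfolding eq[symmetric] by (simp add: exps_ge_def)
    qed
    then show "(\<lambda>e. map (Poly_Mapping.lookup e) [0..<d]) ` (exps d - exps_ge d t) =
        {l. length l = d \<and> sum_list l \<le> t - 1}"
      using lt by (auto simp: deg exps_ge_def)
  qed
  then show "finite (exps d - exps_ge d t)" "card (exps d - exps_ge d t) = (t - 1 + d) choose d"
    using finite_lists_sum_le[of d "t - 1"] card_lists_sum_le[of d "t - 1"]
    by (simp_all add: bij_betw_finite bij_betw_same_card)
qed

lemma exps_diff_exps_frob:
  assumes "t > 0" "q > 0"
  shows "finite (exps d - exps_frob d q t)"
    "card (exps d - exps_frob d q t) = ((t - 1 + d) choose d) * q ^ d"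
proof -
  let ?B = "(exps d - exps_ge d t) \<times> (\<Pi>\<^sub>E i\<in>{..<d}. {..<q})"
  have "bij_betw (\<lambda>e. (exp_of d (\<lambda>i. Poly_Mapping.lookup e i div q),
      restrict (\<lambda>i. Poly_Mapping.lookup e i mod q) {..<d})) (exps d - exps_frob d q t) ?B"
  proof (rule bij_betwI[where g = "\<lambda>(a, f). exp_of d (\<lambda>i. q * Poly_Mapping.lookup a i + f i)"])
    show "(\<lambda>(a, f). exp_of d (\<lambda>i. q * Poly_Mapping.lookup a i + f i)) \<in> ?B \<rightarrow> exps d - exps_frob d q t"
    proof (clarify, intro DiffI)
      fix a f assume a: "a \<in> exps d" "a \<notin> exps_ge d t" and f: "f \<in> (\<Pi>\<^sub>E i\<in>{..<d}. {..<q})"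
      have "(q * Poly_Mapping.lookup a i + f i) div q = Poly_Mapping.lookup a i" if "i < d" for i
        using PiE_mem[OF f, of i] that by simp
      then show "exp_of d (\<lambda>i. q * Poly_Mapping.lookup a i + f i) \<notin> exps_frob d q t"
        using a by (simp add: exps_frob_def exps_ge_def edeg_def)
    qed simp
    show "(case (exp_of d (\<lambda>i. Poly_Mapping.lookup e i div q),
          restrict (\<lambda>i. Poly_Mapping.lookup e i mod q) {..<d}) of
          (a, f) \<Rightarrow> exp_of d (\<lambda>i. q * Poly_Mapping.lookup a i + f i)) = e"
      if "e \<in> exps d - exps_frob d q t" for e
      using that by (auto intro!: exps_eqI[of _ d])
    show "(\<lambda>e. (exp_of d (\<lambda>i. Poly_Mapping.lookup e i div q),
        restrict (\<lambda>i. Poly_Mapping.lookup e i mod q) {..<d})) \<in> (exps d - exps_frob d q t) \<rightarrow> ?B"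
      using assms by (auto simp: exps_frob_def exps_ge_def edeg_def)
    fix y assume "y \<in> ?B"
    then obtain a f where y: "y = (a, f)" "a \<in> exps d" and f: "f \<in> (\<Pi>\<^sub>E i\<in>{..<d}. {..<q})"
      by blast
    have "(q * x + f i) div q = x" "(q * x + f i) mod q = f i" if "i < d" for i x
      using PiE_mem[OF f, of i] that by simp_all
    \<comment> \<open>Outside the index range a member of the product takes the default value,
      exactly what \<open>restrict\<close> produces; this makes the two maps mutually
      inverse.\<close>
    moreover have "f i = undefined" if "\<not> i < d" for i using PiE_arb[OF f, of i] that by simp
    ultimately show "(exp_of d (\<lambda>i. Poly_Mapping.lookup
          (case y of (a, f) \<Rightarrow> exp_of d (\<lambda>i. q * Poly_Mapping.lookup a i + f i)) i div q),
        restrict (\<lambda>i. Poly_Mapping.lookup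
          (case y of (a, f) \<Rightarrow> exp_of d (\<lambda>i. q * Poly_Mapping.lookup a i + f i)) i mod q) {..<d}) = y"
      using y by (auto intro!: exps_eqI[of _ d])
  qed
  moreover have "finite ?B" "card ?B = ((t - 1 + d) choose d) * q ^ d"
    using exps_diff_exps_ge[OF assms(1)] by (simp_all add: finite_PiE card_cartesian_product card_PiE)
  ultimately show "finite (exps d - exps_frob d q t)"
    "card (exps d - exps_frob d q t) = ((t - 1 + d) choose d) * q ^ d"
    by (simp_all add: bij_betw_finite bij_betw_same_card)
qed

text \<open>Outside the Frobenius power the quotients by \<open>q\<close> sum to at most
  \<open>t - 1\<close> and each of the \<open>d\<close> remainders is at most \<open>q - 1\<close>;
  the resulting bound on the degree is attained.\<close>

lemma exps_ge_subset_exps_frob_iff: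
  assumes "t > 0" "q > 0" "d > 0"
  shows "exps_ge d s \<subseteq> exps_frob d q t \<longleftrightarrow> q * (t - 1) + d * (q - 1) < s"
proof
  assume sub: "exps_ge d s \<subseteq> exps_frob d q t"
  define c where "c = q - 1"
  \<comment> \<open>The extremal exponent: every remainder is maximal and the whole quotient
    \<open>t - 1\<close> sits in one variable.\<close>
  define e where "e = exp_of d (\<lambda>i. (if i = 0 then q * (t - 1) else 0) + c)"
  have "c < q" using assms by (simp add: c_def)
  have "edeg d e = q * (t - 1) + d * (q - 1)"
    using assms unfolding c_def[symmetric] by (simp add: edeg_def e_def sum.distrib)
  moreover have "(\<Sum>i<d. Poly_Mapping.lookup e i div q) = (\<Sum>i<d. if i = 0 then t - 1 else 0)"
    using assms \<open>c < q\<close> by (intro sum.cong) (auto simp: e_def)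
  then have "e \<notin> exps_frob d q t" using assms by (auto simp: exps_frob_def)
  ultimately show "q * (t - 1) + d * (q - 1) < s"
    using sub by (force simp: exps_ge_def e_def)
next
  assume s: "q * (t - 1) + d * (q - 1) < s"
  show "exps_ge d s \<subseteq> exps_frob d q t"
  proof
    fix e assume e: "e \<in> exps_ge d s"
    have "Poly_Mapping.lookup e i \<le> q * (Poly_Mapping.lookup e i div q) + (q - 1)" for i
      using mod_less_divisor[OF assms(2), of "Poly_Mapping.lookup e i"]
        mult_div_mod_eq[of q "Poly_Mapping.lookup e i"] by linarith
    then have "edeg d e \<le> (\<Sum>i<d. q * (Poly_Mapping.lookup e i div q) + (q - 1))"
      unfolding edeg_def by (intro sum_mono)
    also have "\<dots> = q * (\<Sum>i<d. Poly_Mapping.lookup e i div q) + d * (q - 1)"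
      by (simp add: sum.distrib sum_distrib_left)
    finally have "q * (t - 1) < q * (\<Sum>i<d. Poly_Mapping.lookup e i div q)"
      using s e unfolding exps_ge_def mem_Collect_eq by linarith
    then have "t - 1 < (\<Sum>i<d. Poly_Mapping.lookup e i div q)" by simp
    then show "e \<in> exps_frob d q t" using e by (simp add: exps_frob_def exps_ge_def)
  qed
qed

text \<open>The set under the supremum is a full initial segment, so the supremum is its explicit
  last element; division by p^n leaves t - 1 + d (1 - p^(-n)).\<close>

lemma F_threshold_loc_max:
  fixes R :: "'k::field poly_nat_vars fract ring"
  assumes p: "Factorial_Ring.prime p" "CHAR('k) = p" and "d > 0" "t > 0" and R: "R = loc_ring d"
  shows "F_threshold p R (ideal_power R (loc_max d) t) (loc_max d) = real (t - 1 + d)"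
proof -
  have "p > 1" by (rule prime_gt_1_nat[OF p(1)])
  have frob: "frobenius_power R (ideal_power R (loc_max d) t) (p ^ n) = mono_ideal d (exps_frob d (p ^ n) t)" for n
    using frobenius_power_mono_ideal[of "p ^ n" n d t, where ?'k = 'k] p
    by (simp add: R ideal_power_loc_max)
  have Sup: "Sup {s. \<not> ideal_power R (loc_max d) s \<subseteq> frobenius_power R (ideal_power R (loc_max d) t) (p ^ n)} =
      p ^ n * (t - 1) + d * (p ^ n - 1)" (is "Sup ?A = ?s") for n
  proof -
    have "p ^ n > 0" using \<open>p > 1\<close> by simp
    then have "?A = {..?s}"
      unfolding frob unfolding R ideal_power_loc_max mono_ideal_subset_iff
        exps_ge_subset_exps_frob_iff[OF \<open>t > 0\<close> \<open>p ^ n > 0\<close> \<open>d > 0\<close>] by auto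
    then show ?thesis by (simp add: cSup_atMost)
  qed
  have "(\<lambda>n. real (t - 1) + real d * (1 - (1 / real p) ^ n)) \<longlonglongrightarrow> real (t - 1) + real d * (1 - 0)"
    using \<open>p > 1\<close> by (intro tendsto_intros LIMSEQ_realpow_zero) auto
  moreover have "real (p ^ n * (t - 1) + d * (p ^ n - 1)) / real p ^ n =
      real (t - 1) + real d * (1 - (1 / real p) ^ n)" for n
    using \<open>p > 1\<close> by (simp add: field_simps of_nat_diff Suc_leI)
  ultimately show ?thesis
    unfolding F_threshold_def Sup by (intro limI) simp
qed

text \<open>The factor p^(nd) in the length cancels exactly against the normalization in dimension
  \<open>d\<close>, leaving a constant sequence.\<close>

lemma e_HK_loc_max_power:
  fixes R :: "'k::field poly_nat_vars fract ring"
  assumes p: "Factorial_Ring.prime p" "CHAR('k) = p" and "t > 0" and R: "R = loc_ring d"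
    and dim: "krull_dim R = enat d"
  shows "e_HK p R (ideal_power R (loc_max d) t) = real ((t - 1 + d) choose d)"
proof -
  have "p > 0" using p by (simp add: prime_gt_0_nat)
  have frob: "frobenius_power R (ideal_power R (loc_max d) t) (p ^ n) = mono_ideal d (exps_frob d (p ^ n) t)" for n
    using frobenius_power_mono_ideal[of "p ^ n" n d t, where ?'k = 'k] p
    by (simp add: R ideal_power_loc_max)
  have "module_length R (quot_module R (mono_ideal d (exps_frob d (p ^ n) t))) =
      enat (((t - 1 + d) choose d) * (p ^ n) ^ d)" for n
    using module_length_mono_ideal[of d "exps_frob d (p ^ n) t", where ?'k = 'k]
      exps_diff_exps_frob[of t "p ^ n" d] \<open>p > 0\<close> \<open>t > 0\<close> by (simp add: R)
  then show ?thesis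
    using \<open>p > 0\<close> by (simp add: e_HK_def frob dim flip: power_mult)
qed

section \<open>Krull dimension\<close>

text \<open>Discard from both factors the terms with exponents in \<open>U\<close>. The product of
  what remains agrees with \<open>f * g\<close> modulo terms in \<open>U\<close>, yet its own
  exponents avoid \<open>U\<close>; so it is zero, and one remainder vanishes because polynomials
  form a domain.\<close>

lemma keys_subset_prime:
  fixes f g :: "'k::field poly_nat_vars"
  assumes U: "exps_ideal d U" and prime: "\<And>a b. a \<notin> U \<Longrightarrow> b \<notin> U \<Longrightarrow> a + b \<notin> U"
    and fg: "f \<in> polys d" "g \<in> polys d" "Poly_Mapping.keys (f * g) \<subseteq> U"
  shows "Poly_Mapping.keys f \<subseteq> U \<or> Poly_Mapping.keys g \<subseteq> U"
proof -
  have split: "\<exists>f1 f2. f = f1 + f2 \<and> Poly_Mapping.keys f1 \<subseteq> U \<and> Poly_Mapping.keys f2 \<inter> U = {} \<and>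
      f1 \<in> polys d \<and> f2 \<in> polys d" if "f \<in> polys d" for f :: "'k poly_nat_vars"
  proof -
    define f1 where "f1 = (\<Sum>e\<in>Poly_Mapping.keys f \<inter> U. Poly_Mapping.single e (Poly_Mapping.lookup f e))"
    have lk: "Poly_Mapping.lookup f1 a = (if a \<in> U then Poly_Mapping.lookup f a else 0)" for a
      by (auto simp: f1_def lookup_sum lookup_single when_def in_keys_iff)
    have "Poly_Mapping.keys f1 \<subseteq> U" "Poly_Mapping.keys f1 \<subseteq> Poly_Mapping.keys f"
      by (auto simp: in_keys_iff lk split: if_splits)
    moreover have "Poly_Mapping.keys (f - f1) \<inter> U = {}" "Poly_Mapping.keys (f - f1) \<subseteq> Poly_Mapping.keys f"
      by (auto simp: in_keys_iff lk lookup_minus split: if_splits)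
    ultimately show ?thesis
      using that by (intro exI[of _ f1] exI[of _ "f - f1"]) (auto simp: polys_iff)
  qed
  obtain f1 f2 where f: "f = f1 + f2" "Poly_Mapping.keys f1 \<subseteq> U" "Poly_Mapping.keys f2 \<inter> U = {}"
      "f1 \<in> polys d" "f2 \<in> polys d"
    using split[OF fg(1)] by blast
  obtain g1 g2 where g: "g = g1 + g2" "Poly_Mapping.keys g1 \<subseteq> U" "Poly_Mapping.keys g2 \<inter> U = {}"
      "g1 \<in> polys d" "g2 \<in> polys d"
    using split[OF fg(2)] by blast
  have "f2 * g2 = f * g + (- (f1 * g) + - (f2 * g1))" by (simp add: f(1) g(1) algebra_simps)
  moreover have "Poly_Mapping.keys (f * g + (- (f1 * g) + - (f2 * g1))) \<subseteq> U"
    using fg(3) keys_mult_subset(1)[OF U f(2) fg(2)] keys_mult_subset(2)[OF U g(2) f(5)]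
    by (intro order_trans[OF Poly_Mapping.keys_add] Un_least) simp_all
  moreover have "Poly_Mapping.keys (f2 * g2) \<inter> U = {}"
    using keys_mult[of f2 g2] prime f(3) g(3) by blast
  ultimately have "Poly_Mapping.keys (f2 * g2) = {}" by (metis inf.absorb1)
  then have "f2 = 0 \<or> g2 = 0" by simp
  then show ?thesis using f g by auto
qed

lemma primeideal_mono_ideal:
  assumes U: "exps_ideal d U" and prime: "\<And>a b. a \<notin> U \<Longrightarrow> b \<notin> U \<Longrightarrow> a + b \<notin> U" and "0 \<notin> U"
  shows "primeideal (mono_ideal d U) (loc_ring d :: 'k::field poly_nat_vars fract ring)"
proof (rule primeidealI)
  show "ideal (mono_ideal d U) (loc_ring d :: 'k poly_nat_vars fract ring)"
    using U by (rule ideal_mono_ideal)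
  show "cring (loc_ring d :: 'k poly_nat_vars fract ring)" by (rule cring_loc_ring)
  show "carrier (loc_ring d) \<noteq> (mono_ideal d U :: 'k poly_nat_vars fract set)"
    using Fract_monom_in_mono_ideal_iff[of 0 d U, where ?'k = 'k]
      Fract_monom_in_mono_ideal_iff[of 0 d "exps d", where ?'k = 'k] \<open>0 \<notin> U\<close>
    by (metis exps_0 loc_ring_simps(1))
  fix x y :: "'k poly_nat_vars fract"
  assume "x \<in> carrier (loc_ring d)" "y \<in> carrier (loc_ring d)"
    and xy: "x \<otimes>\<^bsub>loc_ring d\<^esub> y \<in> mono_ideal d U"
  then obtain f g f' g' where
    x: "x = Fract f g" "Poly_Mapping.keys f \<subseteq> exps d" "g \<in> denoms d" "g \<noteq> 0" and
    y: "y = Fract f' g'" "Poly_Mapping.keys f' \<subseteq> exps d" "g' \<in> denoms d" "g' \<noteq> 0"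
    by (auto elim!: mono_idealE)
  obtain f'' g'' where "x * y = Fract f'' g''" "Poly_Mapping.keys f'' \<subseteq> U" "g'' \<in> denoms d" "g'' \<noteq> 0"
    using xy by (auto elim!: mono_idealE)
  then have eq: "(f * f') * g'' = f'' * (g * g')" using x y by (simp add: eq_fract)
  have p: "f \<in> polys d" "f' \<in> polys d" "g \<in> polys d" "g' \<in> polys d" "g'' \<in> polys d"
    using x(2) y(2) by (simp_all only: polys_iff denoms_polys[OF x(3), unfolded polys_iff]
      denoms_polys[OF y(3), unfolded polys_iff] denoms_polys[OF \<open>g'' \<in> denoms d\<close>, unfolded polys_iff])
  have "Poly_Mapping.keys ((f * f') * g'') \<subseteq> U"
    unfolding eq using \<open>Poly_Mapping.keys f'' \<subseteq> U\<close> p by (intro keys_mult_subset(1)[OF U]) auto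
  \<comment> \<open>A denominator has a nonzero constant term and \<open>0\<close> is not in
    \<open>U\<close>, so primality at the level of polynomials allows it to be cancelled.\<close>
  moreover have "\<not> Poly_Mapping.keys g'' \<subseteq> U"
    using \<open>g'' \<in> denoms d\<close> \<open>0 \<notin> U\<close> by (auto simp: denoms_def in_keys_iff)
  ultimately have "Poly_Mapping.keys (f * f') \<subseteq> U"
    using keys_subset_prime[OF U prime, of "f * f'" g''] p by blast
  then have "Poly_Mapping.keys f \<subseteq> U \<or> Poly_Mapping.keys f' \<subseteq> U"
    using keys_subset_prime[OF U prime, of f f'] p by blast
  then show "x \<in> mono_ideal d U \<or> y \<in> mono_ideal d U"
    using x y by (auto intro: mono_idealI)
qed

section \<open>Algebraic dependence by counting monomials\<close>

lemma const_add: "const (a + b) = const a + const b"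
  by (simp add: const_def single_add)

lemma const_mult: "const (a * b) = const a * const b"
  by (simp add: const_def mult_single)

lemma const_1 [simp]: "const 1 = 1"
  by (simp add: const_def)

lemma vector_space_poly_nat_vars:
  "vector_space (\<lambda>c f. const c * f :: 'k::field poly_nat_vars)"
  by unfold_locales (simp_all add: const_add const_mult algebra_simps)

text \<open>Bounding each exponent separately, rather than the degree, gives a count that is a plain
  power and a bound that adds under multiplication.\<close>

definition exps_box :: "nat \<Rightarrow> nat \<Rightarrow> (nat \<Rightarrow>\<^sub>0 nat) set" where
  "exps_box d B = {e \<in> exps d. \<forall>i<d. Poly_Mapping.lookup e i \<le> B}"

lemma exps_box_card: "finite (exps_box d B)" "card (exps_box d B) \<le> Suc B ^ d"
proof -
  let ?F = "\<Pi>\<^sub>E i\<in>{..<d}. {..B}"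
  have sub: "exps_box d B \<subseteq> exp_of d ` ?F"
  proof
    fix e assume e: "e \<in> exps_box d B"
    have "e = exp_of d (restrict (Poly_Mapping.lookup e) {..<d})"
      using e by (intro exps_eqI[of _ d]) (auto simp: exps_box_def)
    moreover have "restrict (Poly_Mapping.lookup e) {..<d} \<in> ?F" using e by (auto simp: exps_box_def)
    ultimately show "e \<in> exp_of d ` ?F" by (metis image_eqI)
  qed
  have fin: "finite ?F" by (simp add: finite_PiE)
  then show "finite (exps_box d B)" using sub by (meson finite_imageI finite_subset)
  have "card (exps_box d B) \<le> card (exp_of d ` ?F)" using sub fin by (intro card_mono) auto
  also have "\<dots> \<le> card ?F" using fin by (rule card_image_le)
  finally show "card (exps_box d B) \<le> Suc B ^ d" by (simp add: card_PiE)
qed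

lemma keys_mult_exps_box:
  assumes "Poly_Mapping.keys f \<subseteq> exps_box d A" "Poly_Mapping.keys g \<subseteq> exps_box d B"
  shows "Poly_Mapping.keys (f * g) \<subseteq> exps_box d (A + B)"
  using keys_mult[of f g] assms by (fastforce simp: exps_box_def lookup_add intro: add_mono)

lemma keys_power_exps_box:
  "Poly_Mapping.keys f \<subseteq> exps_box d A \<Longrightarrow> Poly_Mapping.keys (f ^ n) \<subseteq> exps_box d (n * A)"
proof (induction n)
  case 0
  then show ?case by (auto simp: exps_box_def)
next
  case (Suc n)
  then show ?case using keys_mult_exps_box[of f d A "f ^ n" "n * A"] by simp
qed

lemma keys_prod_exps_box:
  "finite S \<Longrightarrow> (\<And>i. i \<in> S \<Longrightarrow> Poly_Mapping.keys (f i) \<subseteq> exps_box d (A i)) \<Longrightarrow>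
    Poly_Mapping.keys (\<Prod>i\<in>S. f i :: 'k::field poly_nat_vars) \<subseteq> exps_box d (\<Sum>i\<in>S. A i)"
proof (induction S rule: finite_induct)
  case empty
  then show ?case by (auto simp: exps_box_def)
next
  case (insert i S)
  then show ?case using keys_mult_exps_box[of "f i" d "A i" "prod f S" "sum A S"] by simp
qed

lemma exps_box_mono: "A \<le> B \<Longrightarrow> exps_box d A \<subseteq> exps_box d B"
  by (auto simp: exps_box_def intro: order_trans)

text \<open>For large \<open>N\<close>, the \<open>N ^ (d + 1)\<close> power products with exponents below \<open>N\<close> lie in the span of
  \<open>O(N ^ d)\<close> monomials.\<close>

lemma algebraic_dependence:
  fixes h :: "nat \<Rightarrow> 'k::field poly_nat_vars"
  assumes h: "\<And>i. i \<le> d \<Longrightarrow> h i \<in> polys d"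
  obtains A :: "(nat \<Rightarrow> nat) set" and c where "finite A" "A \<noteq> {}" "A \<subseteq> extensional {..d}"
    "\<forall>\<alpha>\<in>A. c \<alpha> \<noteq> 0" "(\<Sum>\<alpha>\<in>A. const (c \<alpha>) * (\<Prod>i\<le>d. h i ^ \<alpha> i)) = 0"
proof -
  interpret vs: vector_space "\<lambda>c f. const c * f :: 'k poly_nat_vars"
    by (rule vector_space_poly_nat_vars)
  define E where "E = (\<Union>i\<le>d. Poly_Mapping.keys (h i))"
  \<comment> \<open>A crude common bound: every single exponent occurring in some \<open>h i\<close>
    is at most the sum of all degrees occurring.\<close>
  define B where "B = (\<Sum>e\<in>E. edeg d e)"
  have hB: "Poly_Mapping.keys (h i) \<subseteq> exps_box d B" if i: "i \<le> d" for i
  proof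
    fix e assume e: "e \<in> Poly_Mapping.keys (h i)"
    have "Poly_Mapping.lookup e j \<le> B" if "j < d" for j
    proof -
      have "Poly_Mapping.lookup e j \<le> edeg d e"
        unfolding edeg_def using that by (intro member_le_sum) auto
      also have "\<dots> \<le> B" unfolding B_def using e i by (intro member_le_sum) (auto simp: E_def)
      finally show ?thesis .
    qed
    then show "e \<in> exps_box d B" using e h[OF i] by (auto simp: exps_box_def polys_iff)
  qed
  \<comment> \<open>The monomials available number at most \<open>(N * C) ^ d\<close>, since
    \<open>Suc (Suc d * (N * B))\<close> is at most \<open>N * C\<close>. Taking \<open>N\<close>
    larger than \<open>C ^ d\<close> pushes this below \<open>N ^ Suc d\<close>, the number of power
    products.\<close>
  define C where "C = Suc (Suc d * B)"
  define N where "N = Suc (C ^ d)"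
  define S where "S = (\<Pi>\<^sub>E i\<in>{..d}. {..<N})"
  define T where "T \<alpha> = (\<Prod>i\<le>d. h i ^ \<alpha> i)" for \<alpha> :: "nat \<Rightarrow> nat"
  define G where "G = (monom ` exps_box d (Suc d * (N * B)) :: 'k poly_nat_vars set)"
  have S: "finite S" "card S = N ^ Suc d" by (simp_all add: S_def finite_PiE card_PiE)
  have G: "finite G" by (simp add: G_def exps_box_card)
  have "card G \<le> Suc (Suc d * (N * B)) ^ d"
    unfolding G_def by (rule order_trans[OF card_image_le exps_box_card(2)]) (rule exps_box_card)
  also have "\<dots> \<le> (N * C) ^ d"
    by (rule power_mono) (simp_all add: C_def N_def algebra_simps)
  also have "\<dots> < N ^ Suc d"
  proof -
    have "N ^ d * C ^ d < N ^ d * N" by (simp add: N_def)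
    then show ?thesis by (simp only: power_mult_distrib power_Suc mult.commute)
  qed
  finally have less: "card G < card S" by (simp add: S)
  have span: "T \<alpha> \<in> vs.span G" if \<alpha>: "\<alpha> \<in> S" for \<alpha>
  proof -
    have "Poly_Mapping.keys (h i ^ \<alpha> i) \<subseteq> exps_box d (N * B)" if "i \<le> d" for i
    proof -
      have "\<alpha> i \<le> N" using PiE_mem[of \<alpha> "{..d}" "\<lambda>_. {..<N}" i] that \<alpha> by (simp add: S_def)
      then show ?thesis
        by (intro order_trans[OF keys_power_exps_box[OF hB[OF that]] exps_box_mono]) simp
    qed
    then have "Poly_Mapping.keys (T \<alpha>) \<subseteq> exps_box d (Suc d * (N * B))"
      using keys_prod_exps_box[of "{..d}" "\<lambda>i. h i ^ \<alpha> i" d "\<lambda>_. N * B"] by (simp add: T_def)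
    then show ?thesis
      by (subst poly_eq_sum_monom[of "T \<alpha>"], intro vs.span_sum vs.span_scale vs.span_base)
        (auto simp only: G_def)
  qed
  show ?thesis
  proof (cases "inj_on T S")
    \<comment> \<open>Two equal power products are already a relation, with coefficients 1 and -1.
      Otherwise linear dependence of the set of values can be pulled back to the tuples.\<close>
    case False
    then obtain \<alpha> \<beta> where ab: "\<alpha> \<in> S" "\<beta> \<in> S" "\<alpha> \<noteq> \<beta>" "T \<alpha> = T \<beta>" by (auto simp: inj_on_def)
    show ?thesis
    proof (rule that[of "{\<alpha>, \<beta>}" "\<lambda>\<gamma>. if \<gamma> = \<alpha> then 1 else - 1"])
      have "const (- 1 :: 'k) = - 1" by (simp add: const_def single_uminus)
      then show "(\<Sum>\<gamma>\<in>{\<alpha>, \<beta>}. const (if \<gamma> = \<alpha> then 1 else - 1 :: 'k) * (\<Prod>i\<le>d. h i ^ \<gamma> i)) = 0"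
        using ab by (simp add: T_def)
    qed (use ab in \<open>auto simp: S_def PiE_def\<close>)
  next
    case True
    then have "card (T ` S) = card S" by (rule card_image)
    then have "vs.dependent (T ` S)"
      using vs.independent_span_bound[OF G, of "T ` S"] span less by fastforce
    then obtain t u where t: "finite t" "t \<subseteq> T ` S" "(\<Sum>v\<in>t. const (u v) * v) = 0" "\<exists>v\<in>t. u v \<noteq> 0"
      unfolding vs.dependent_explicit by blast
    \<comment> \<open>Zero coefficients are dropped because evaluation along a chain of primes ends
      with a coefficient that has to be invertible.\<close>
    define A where "A = {\<alpha> \<in> S. T \<alpha> \<in> t \<and> u (T \<alpha>) \<noteq> 0}"
    have "A \<subseteq> S" by (auto simp: A_def)
    show ?thesis
    proof (rule that[of A "\<lambda>\<alpha>. u (T \<alpha>)"])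
      show "finite A" using \<open>A \<subseteq> S\<close> S(1) by (rule finite_subset)
      show "A \<noteq> {}" using t(2,4) by (auto simp: A_def)
      show "A \<subseteq> extensional {..d}" using \<open>A \<subseteq> S\<close> by (auto simp: S_def PiE_def)
      have "(\<Sum>\<alpha>\<in>A. const (u (T \<alpha>)) * T \<alpha>) = (\<Sum>v\<in>T ` A. const (u v) * v)"
        using inj_on_subset[OF True \<open>A \<subseteq> S\<close>] by (simp add: sum.reindex)
      also have "\<dots> = (\<Sum>v\<in>t. const (u v) * v)"
      proof (rule sum.mono_neutral_left[OF t(1)])
        show "T ` A \<subseteq> t" by (auto simp: A_def)
        have "u v = 0" if "v \<in> t - T ` A" for v
          using that t(2) unfolding A_def by blast
        then show "\<forall>v\<in>t - T ` A. const (u v) * v = 0" by (simp add: const_def)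
      qed
      finally show "(\<Sum>\<alpha>\<in>A. const (u (T \<alpha>)) * (\<Prod>i\<le>d. h i ^ \<alpha> i)) = 0"
        using t(3) by (simp add: T_def)
    qed (auto simp: A_def)
  qed
qed

section \<open>Values of polynomials along a chain of primes\<close>

lemma carrier_prod:
  assumes "\<And>i. i \<in> S \<Longrightarrow> f i \<in> mono_ideal d (exps d)"
  shows "(\<Prod>i\<in>S. f i ^ n i) \<in> (mono_ideal d (exps d) :: 'k::field poly_nat_vars fract set)"
proof -
  have mult: "x * y \<in> mono_ideal d (exps d)"
    if "x \<in> mono_ideal d (exps d)" "y \<in> mono_ideal d (exps d)" for x y :: "'k poly_nat_vars fract"
    by (rule mono_ideal_mult[OF _ that]) simp
  have pow: "x ^ k \<in> mono_ideal d (exps d)"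
    if "x \<in> mono_ideal d (exps d)" for x :: "'k poly_nat_vars fract" and k
    by (induction k) (simp_all add: mult that)
  show ?thesis
    using assms by (induction S rule: infinite_finite_induct) (simp_all add: mult pow)
qed

lemma carrier_power: "x \<in> mono_ideal d (exps d) \<Longrightarrow> x ^ n \<in> mono_ideal d (exps d)"
  using carrier_prod[of "{0::nat}" "\<lambda>_. x" d "\<lambda>_. n"] by simp

text \<open>Evaluating a nonzero polynomial at elements of successive differences of a chain of primes:
  peeling off the lowest power of the \<open>j\<close>-th argument moves from \<open>P j\<close> to \<open>P (Suc j)\<close>, until a
  nonzero constant is left.\<close>

lemma prime_chain_value_notin:
  fixes H :: "nat \<Rightarrow> 'k::field poly_nat_vars fract"
  assumes P: "\<And>i. i \<le> Suc d \<Longrightarrow> primeideal (P i) (loc_ring d)"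
    and H: "\<And>i. i \<le> d \<Longrightarrow> H i \<in> P (Suc i) - P i"
    and mono: "\<And>i. i \<le> d \<Longrightarrow> P i \<subseteq> P (Suc i)"
    and "j \<le> Suc d"
    and A: "finite A" "A \<noteq> {}" "\<And>\<alpha>. \<alpha> \<in> A \<Longrightarrow> c \<alpha> \<noteq> 0"
      "inj_on (\<lambda>\<alpha>. restrict \<alpha> {j..d}) A"
  shows "(\<Sum>\<alpha>\<in>A. Fract (const (c \<alpha>)) 1 * (\<Prod>i\<in>{j..d}. H i ^ \<alpha> i)) \<notin> P j"
  using \<open>j \<le> Suc d\<close> A
proof (induction j arbitrary: A rule: inc_induct)
  case base
  then obtain \<alpha> where "\<alpha> \<in> A" by blast
  \<comment> \<open>No coordinates remain, so injectivity of the restriction leaves a single tuple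
    and the sum is its constant coefficient.\<close>
  then have A: "A = {\<alpha>}" using base(4) by (auto simp: inj_on_def restrict_def)
  interpret Q: primeideal "P (Suc d)" "loc_ring d :: 'k poly_nat_vars fract ring" using P by simp
  have I: "ideal (P (Suc d)) (loc_ring d)" by (rule Q.is_ideal)
  show ?case
  proof
    assume "(\<Sum>\<alpha>\<in>A. Fract (const (c \<alpha>)) 1 * (\<Prod>i\<in>{Suc d..d}. H i ^ \<alpha> i)) \<in> P (Suc d)"
    then have "Fract (const (c \<alpha>)) 1 \<in> P (Suc d)" by (simp add: A)
    then have "Fract (const (inverse (c \<alpha>))) 1 * Fract (const (c \<alpha>)) 1 \<in> P (Suc d)"
      by (intro ideal_loc_ringD(5)[OF I] Fract_in_carrier) auto
    also have "Fract (const (inverse (c \<alpha>))) 1 * Fract (const (c \<alpha>)) 1 = 1"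
      using base(3)[OF \<open>\<alpha> \<in> A\<close>] by (simp add: One_fract_def flip: const_mult)
    finally have "1 \<in> P (Suc d)" .
    then show False using Q.one_imp_carrier Q.I_notcarr by simp
  qed
next
  case (step j)
  then have "j \<le> d" by simp
  interpret Q: primeideal "P j" "loc_ring d :: 'k poly_nat_vars fract ring" using P \<open>j \<le> d\<close> by simp
  interpret Q': primeideal "P (Suc j)" "loc_ring d :: 'k poly_nat_vars fract ring"
    using P \<open>j \<le> d\<close> by simp
  have I': "ideal (P (Suc j)) (loc_ring d)" by (rule Q'.is_ideal)
  have Hc: "H i \<in> mono_ideal d (exps d)" if "i \<le> d" for i
    using H[OF that] P[of "Suc i"] that ideal_loc_ringD(1)[of "P (Suc i)" d] primeideal.axioms(1) by blast
  have cc: "Fract (const a) 1 \<in> mono_ideal d (exps d)" for a :: 'k by (intro Fract_in_carrier) simp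
  have mult: "x * y \<in> mono_ideal d (exps d)"
    if "x \<in> mono_ideal d (exps d)" "y \<in> mono_ideal d (exps d)" for x y :: "'k poly_nat_vars fract"
    by (rule mono_ideal_mult[OF _ that]) simp
  define m where "m = Min ((\<lambda>\<alpha>. \<alpha> j) ` A)"
  have m_le: "m \<le> \<alpha> j" if "\<alpha> \<in> A" for \<alpha> using that step.prems(1) by (simp add: m_def)
  \<comment> \<open>After division by \<open>H j ^ m\<close> these terms are free of
    \<open>H j\<close>, while all others keep a positive power of it and fall into
    \<open>P (Suc j)\<close>. Sharing the entry at \<open>j\<close>, they remain distinguishable by
    the later ones.\<close>
  define A' where "A' = {\<alpha> \<in> A. \<alpha> j = m}"
  have "m \<in> (\<lambda>\<alpha>. \<alpha> j) ` A" unfolding m_def using step.prems by (intro Min_in) auto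
  then have "A' \<noteq> {}" by (auto simp: A'_def)
  have "A' \<subseteq> A" by (auto simp: A'_def)
  define t where "t \<alpha> = Fract (const (c \<alpha>)) 1 * (\<Prod>i\<in>{Suc j..d}. H i ^ \<alpha> i)" for \<alpha>
  have tc: "t \<alpha> \<in> mono_ideal d (exps d)" for \<alpha>
    unfolding t_def by (intro mult cc carrier_prod Hc) simp
  define u where "u = (\<Sum>\<alpha>\<in>A. H j ^ (\<alpha> j - m) * t \<alpha>)"
  have R: "ideal (carrier (loc_ring d)) (loc_ring d :: 'k poly_nat_vars fract ring)" by (rule Q.oneideal)
  have "inj_on (\<lambda>\<alpha>. restrict \<alpha> {Suc j..d}) A'"
  proof (rule inj_onI)
    fix \<alpha> \<beta> assume ab: "\<alpha> \<in> A'" "\<beta> \<in> A'" "restrict \<alpha> {Suc j..d} = restrict \<beta> {Suc j..d}"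
    have "\<alpha> i = \<beta> i" if "i \<in> {j..d}" for i
      using fun_cong[OF ab(3), of i] ab(1,2) that by (cases "i = j") (auto simp: A'_def)
    then have "restrict \<alpha> {j..d} = restrict \<beta> {j..d}" by (rule restrict_ext)
    then show "\<alpha> = \<beta>" using inj_onD[OF step.prems(4)] ab(1,2) \<open>A' \<subseteq> A\<close> by blast
  qed
  moreover have "c \<alpha> \<noteq> 0" if "\<alpha> \<in> A'" for \<alpha> using step.prems(3) that \<open>A' \<subseteq> A\<close> by blast
  ultimately have notin: "(\<Sum>\<alpha>\<in>A'. t \<alpha>) \<notin> P (Suc j)"
    unfolding t_def using finite_subset[OF \<open>A' \<subseteq> A\<close> step.prems(1)] \<open>A' \<noteq> {}\<close>
    by (intro step.IH)
  show ?case
  proof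
    assume in_P: "(\<Sum>\<alpha>\<in>A. Fract (const (c \<alpha>)) 1 * (\<Prod>i\<in>{j..d}. H i ^ \<alpha> i)) \<in> P j"
    have "Fract (const (c \<alpha>)) 1 * (\<Prod>i\<in>{j..d}. H i ^ \<alpha> i) = H j ^ m * (H j ^ (\<alpha> j - m) * t \<alpha>)"
      if "\<alpha> \<in> A" for \<alpha>
    proof -
      have "H j ^ \<alpha> j = H j ^ m * H j ^ (\<alpha> j - m)" using m_le[OF that] by (simp flip: power_add)
      moreover have "{j..d} = insert j {Suc j..d}" using \<open>j \<le> d\<close> by auto
      then have "(\<Prod>i\<in>{j..d}. H i ^ \<alpha> i) = H j ^ \<alpha> j * (\<Prod>i\<in>{Suc j..d}. H i ^ \<alpha> i)" by simp
      ultimately show ?thesis by (simp only: t_def mult_ac)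
    qed
    then have "(\<Sum>\<alpha>\<in>A. Fract (const (c \<alpha>)) 1 * (\<Prod>i\<in>{j..d}. H i ^ \<alpha> i)) = H j ^ m * u"
      by (simp add: u_def sum_distrib_left cong: sum.cong)
    then have Hu: "H j ^ m * u \<in> P j" using in_P by simp
    have uc: "u \<in> mono_ideal d (exps d)"
      unfolding u_def by (rule ideal_loc_ringD(6)[OF R, unfolded loc_ring_simps])
        (intro mult carrier_power Hc \<open>j \<le> d\<close> tc)
    \<comment> \<open>Since \<open>H j\<close> lies outside the prime \<open>P j\<close>, its powers
      cancel one at a time.\<close>
    have "H j ^ k * u \<in> P j \<Longrightarrow> u \<in> P j" for k
    proof (induction k)
      case (Suc k)
      have "H j * (H j ^ k * u) \<in> P j" using Suc.prems by (simp add: mult.assoc)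
      then have "H j \<in> P j \<or> H j ^ k * u \<in> P j"
        using Q.I_prime[of "H j" "H j ^ k * u"] Hc[OF \<open>j \<le> d\<close>]
          mult[OF carrier_power[OF Hc[OF \<open>j \<le> d\<close>]] uc, of k] by simp
      then show ?case using H[OF \<open>j \<le> d\<close>] Suc.IH by blast
    qed simp
    then have "u \<in> P (Suc j)" using Hu mono[OF \<open>j \<le> d\<close>] by blast
    moreover have "(\<Sum>\<alpha>\<in>A - A'. H j ^ (\<alpha> j - m) * t \<alpha>) \<in> P (Suc j)"
    proof (rule ideal_loc_ringD(6)[OF I'])
      fix \<alpha> assume "\<alpha> \<in> A - A'"
      then have "\<alpha> j > m" using m_le[of \<alpha>] by (auto simp: A'_def)
      then obtain k where k: "\<alpha> j - m = Suc k" by (metis Suc_diff_Suc)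
      have "(H j ^ k * t \<alpha>) * H j \<in> P (Suc j)"
        using H[OF \<open>j \<le> d\<close>] by (intro ideal_loc_ringD(5)[OF I'] mult carrier_power Hc tc) (use \<open>j \<le> d\<close> in auto)
      then show "H j ^ (\<alpha> j - m) * t \<alpha> \<in> P (Suc j)" by (simp add: k mult_ac)
    qed
    ultimately have "u - (\<Sum>\<alpha>\<in>A - A'. H j ^ (\<alpha> j - m) * t \<alpha>) \<in> P (Suc j)"
      by (rule ideal_loc_ringD(4)[OF I'])
    also have "u - (\<Sum>\<alpha>\<in>A - A'. H j ^ (\<alpha> j - m) * t \<alpha>) = (\<Sum>\<alpha>\<in>A'. H j ^ (\<alpha> j - m) * t \<alpha>)"
      unfolding u_def using sum.subset_diff[OF \<open>A' \<subseteq> A\<close> step.prems(1)] by (simp add: algebra_simps)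
    also have "\<dots> = (\<Sum>\<alpha>\<in>A'. t \<alpha>)" by (simp add: A'_def)
    finally show False using notin by blast
  qed
qed

text \<open>Ideals generated by initial segments of the variables give a chain of length
  \<open>d\<close>. A longer chain would supply \<open>d + 1\<close> polynomials whose algebraic
  relation evaluates to zero, which lies in every ideal, against the nonvanishing result modulo the
  lowest prime.\<close>

lemma krull_dim_loc_ring:
  "krull_dim (loc_ring d :: 'k::field poly_nat_vars fract ring) = enat d"
  unfolding krull_dim_def
proof (rule chain_sup_eqI)
  define U where "U i = {e \<in> exps d. \<exists>j<i. Poly_Mapping.lookup e j \<noteq> 0}" for i
  fix i
  show "primeideal (mono_ideal d (U i)) (loc_ring d :: 'k poly_nat_vars fract ring)"
  proof (rule primeideal_mono_ideal)
    show "exps_ideal d (U i)" by (rule exps_idealI) (auto simp: U_def lookup_add)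
  qed (auto simp: U_def lookup_add)
  show "mono_ideal d (U i) \<subset> (mono_ideal d (U (Suc i)) :: 'k poly_nat_vars fract set)" if "i < d"
  proof (rule mono_ideal_strict_mono)
    have "Poly_Mapping.single i 1 \<in> U (Suc i) - U i"
      using that by (auto simp: U_def lookup_single when_def)
    moreover have "U i \<subseteq> U (Suc i)" unfolding U_def using less_SucI by blast
    ultimately show "U i \<subset> U (Suc i)" by blast
  qed
next
  fix n :: nat and C :: "nat \<Rightarrow> 'k poly_nat_vars fract set"
  assume prime: "\<And>i. i \<le> n \<Longrightarrow> primeideal (C i) (loc_ring d)" and C: "\<And>i. i < n \<Longrightarrow> C i \<subset> C (Suc i)"
  show "n \<le> d"
  proof (rule ccontr)
    assume "\<not> n \<le> d"
    \<comment> \<open>Multiplying by a denominator, a unit of the ring, replaces a witness of strict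
      inclusion by a polynomial, as the dependence argument requires.\<close>
    have ex: "\<exists>f\<in>polys d. Fract f 1 \<in> C (Suc i) - C i" if i: "i \<le> d" for i
    proof -
      have I: "ideal (C i) (loc_ring d)" "ideal (C (Suc i)) (loc_ring d)"
        using primeideal.axioms(1)[OF prime] \<open>\<not> n \<le> d\<close> i by simp_all
      obtain x where x: "x \<in> C (Suc i)" "x \<notin> C i" using C[of i] i \<open>\<not> n \<le> d\<close> by auto
      then have "x \<in> mono_ideal d (exps d)" using ideal_loc_ringD(1)[OF I(2)] by blast
      then obtain f g where fg: "x = Fract f g" "Poly_Mapping.keys f \<subseteq> exps d" "g \<in> denoms d" "g \<noteq> 0"
        by (rule mono_idealE)
      have eq: "Fract f 1 = Fract g 1 * x" "x = Fract 1 g * Fract f 1"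
        using fg by (simp_all add: eq_fract)
      have "Fract g 1 * x \<in> C (Suc i)"
        by (intro ideal_loc_ringD(5)[OF I(2)] Fract_in_carrier denoms_polys fg x)
      moreover have "Fract 1 g * Fract f 1 \<in> C i" if "Fract f 1 \<in> C i"
        using that fg(3) by (intro ideal_loc_ringD(5)[OF I(1)] mono_idealI) auto
      ultimately have "Fract f 1 \<in> C (Suc i) - C i"
        unfolding eq(1)[symmetric] eq(2)[symmetric] using x(2) by blast
      moreover have "f \<in> polys d" using fg(2) unfolding polys_iff .
      ultimately show ?thesis by blast
    qed
    then have "\<forall>i\<in>{..d}. \<exists>f. f \<in> polys d \<and> Fract f 1 \<in> C (Suc i) - C i" by blast
    from bchoice[OF this] obtain h where
      "\<forall>i\<in>{..d}. h i \<in> polys d \<and> Fract (h i) 1 \<in> C (Suc i) - C i" by blast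
    then have h: "\<And>i. i \<le> d \<Longrightarrow> h i \<in> polys d"
        "\<And>i. i \<le> d \<Longrightarrow> Fract (h i) 1 \<in> C (Suc i) - C i"
      by simp_all
    obtain A c where A: "finite A" "A \<noteq> {}" "A \<subseteq> extensional {..d}"
        "\<forall>\<alpha>\<in>A. c \<alpha> \<noteq> 0" "(\<Sum>\<alpha>\<in>A. const (c \<alpha>) * (\<Prod>i\<le>d. h i ^ \<alpha> i)) = 0"
      using h(1) by (rule algebraic_dependence)
    have "(\<Sum>\<alpha>\<in>A. Fract (const (c \<alpha>)) 1 * (\<Prod>i\<in>{0..d}. Fract (h i) 1 ^ \<alpha> i)) \<notin> C 0"
    proof (rule prime_chain_value_notin[where d = d and P = C])
      \<comment> \<open>Extensional tuples are determined by their entries up to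
        \<open>d\<close>.\<close>
      show "inj_on (\<lambda>\<alpha>. restrict \<alpha> {0..d}) A"
        using A(3) by (intro inj_onI) (metis atMost_atLeast0 extensional_restrict subsetD)
      show "C i \<subseteq> C (Suc i)" if "i \<le> d" for i using C[of i] that \<open>\<not> n \<le> d\<close> by auto
    qed (use prime \<open>\<not> n \<le> d\<close> h A in simp_all)
    moreover have fprod: "Fract (\<Prod>i\<in>S. h i ^ \<alpha> i) 1 = (\<Prod>i\<in>S. Fract (h i) 1 ^ \<alpha> i)" for S and \<alpha> :: "nat \<Rightarrow> nat"
    proof (induction S rule: infinite_finite_induct)
      case (insert i S)
      have "Fract (h i ^ \<alpha> i * (\<Prod>i\<in>S. h i ^ \<alpha> i)) 1 = Fract (h i) 1 ^ \<alpha> i * Fract (\<Prod>i\<in>S. h i ^ \<alpha> i) 1"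
        by (simp add: Fract_power)
      then show ?case using insert by simp
    qed (simp_all add: One_fract_def)
    have "(\<Sum>\<alpha>\<in>A. Fract (const (c \<alpha>)) 1 * (\<Prod>i\<in>{0..d}. Fract (h i) 1 ^ \<alpha> i)) =
        Fract (\<Sum>\<alpha>\<in>A. const (c \<alpha>) * (\<Prod>i\<le>d. h i ^ \<alpha> i)) 1"
    proof -
      have "Fract (const (c \<alpha>) * (\<Prod>i\<in>{0..d}. h i ^ \<alpha> i)) 1 =
          Fract (const (c \<alpha>)) 1 * (\<Prod>i\<in>{0..d}. Fract (h i) 1 ^ \<alpha> i)" for \<alpha>
        unfolding fprod[symmetric] by simp
      then show ?thesis by (simp only: Fract_sum atMost_atLeast0)
    qed
    moreover have "0 \<in> C 0" by (rule ideal_loc_ringD(2)[OF primeideal.axioms(1)[OF prime]]) simp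
    ultimately show False by (simp add: A(5) fract_collapse)
  qed
qed

section \<open>Noetherianity\<close>

lemma nat_seq_incseq_subseq:
  fixes y :: "nat \<Rightarrow> nat"
  obtains s where "strict_mono s" "incseq (y \<circ> s)"
proof -
  obtain s where s: "strict_mono s" "monoseq (\<lambda>n. y (s n))" using seq_monosub[of y] by blast
  show ?thesis
  proof (cases "incseq (\<lambda>n. y (s n))")
    case True
    then show ?thesis using s that[of s] by (simp add: o_def)
  next
    case False
    then have dec: "decseq (\<lambda>n. y (s n))" using s(2) by (simp add: monoseq_iff)
    \<comment> \<open>From an index where the minimum is reached, a decreasing sequence of naturals
      is constant and therefore also increasing.\<close>
    obtain n where n: "\<And>k. y (s n) \<le> y (s k)"
      using ex_has_least_nat[of "\<lambda>_. True" _ "\<lambda>n. y (s n)"] by blast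
    have "y (s (n + k)) = y (s n)" for k
      using n[of "n + k"] decseqD[OF dec, of n "n + k"] by simp
    then have "incseq (y \<circ> (\<lambda>k. s (n + k)))" by (simp add: o_def incseq_def)
    moreover have "strict_mono (\<lambda>k. s (n + k))" using s(1) by (simp add: strict_mono_def)
    ultimately show ?thesis using that by blast
  qed
qed

text \<open>Thin out one coordinate at a time: passing to a further subsequence preserves the
  monotonicity already achieved.\<close>

lemma dickson_subseq:
  fixes x :: "nat \<Rightarrow> nat \<Rightarrow> nat"
  shows "\<exists>r. strict_mono r \<and> (\<forall>k<d. incseq (\<lambda>n. x (r n) k))"
proof (induction d)
  case 0
  then show ?case by (intro exI[of _ id]) (simp add: strict_mono_def)
next
  case (Suc d)
  then obtain r where r: "strict_mono r" "\<forall>k<d. incseq (\<lambda>n. x (r n) k)" by blast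
  obtain s where s: "strict_mono s" "incseq ((\<lambda>n. x (r n) d) \<circ> s)"
    by (rule nat_seq_incseq_subseq)
  have "incseq (\<lambda>n. x ((r \<circ> s) n) k)" if "k < Suc d" for k
  proof (cases "k = d")
    case False
    then have "incseq (\<lambda>n. x (r n) k)" using that r(2) by simp
    then show ?thesis
      using strict_mono_mono[OF s(1)] by (auto simp: incseq_def mono_def)
  qed (use s(2) in \<open>simp add: o_def\<close>)
  then show ?case using strict_mono_o[OF r(1) s(1)] by blast
qed

lemma dickson_seq:
  assumes "\<And>n. e n \<in> exps d"
  obtains i j a where "i < (j :: nat)" "a \<in> exps d" "e j = a + e i"
proof -
  obtain r where r: "strict_mono r" "\<forall>k<d. incseq (\<lambda>n. Poly_Mapping.lookup (e (r n)) k)"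
    using dickson_subseq[of d "\<lambda>n. Poly_Mapping.lookup (e n)"] by blast
  \<comment> \<open>The coordinates increase from \<open>r 0\<close> to \<open>r 1\<close>, so the
    truncated subtraction is a true difference.\<close>
  define a where "a = exp_of d (\<lambda>k. Poly_Mapping.lookup (e (r 1)) k - Poly_Mapping.lookup (e (r 0)) k)"
  have "Poly_Mapping.lookup (e (r 0)) k \<le> Poly_Mapping.lookup (e (r 1)) k" if "k < d" for k
    using r(2) that by (simp add: incseq_def)
  then have "e (r 1) = a + e (r 0)"
    using assms by (intro exps_eqI[of _ d]) (auto simp: a_def lookup_add)
  moreover have "r 0 < r 1" using r(1) by (simp add: strict_mono_def)
  moreover have "a \<in> exps d" by (simp add: a_def)
  ultimately show ?thesis using that by blast
qed

text \<open>The basis consists of the elements minimal for divisibility. Infinitely many of them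
  would form a sequence in which one divides a later one; and a divisor of least degree inside
  \<open>L\<close> is minimal.\<close>

lemma dickson_finite_basis:
  assumes "L \<subseteq> exps d"
  obtains B where "finite B" "B \<subseteq> L" "\<forall>e\<in>L. \<exists>b\<in>B. \<exists>a\<in>exps d. e = a + b"
proof
  define B where "B = {b \<in> L. \<forall>e\<in>L. \<forall>a\<in>exps d. b = a + e \<longrightarrow> e = b}"
  show "B \<subseteq> L" by (auto simp: B_def)
  show "finite B"
  proof (rule ccontr)
    assume "infinite B"
    then obtain e :: "nat \<Rightarrow> nat \<Rightarrow>\<^sub>0 nat" where e: "inj e" "range e \<subseteq> B"
      using infinite_countable_subset by blast
    then have B: "e n \<in> B" for n by blast
    then have "e n \<in> exps d" for n using assms by (auto simp: B_def)
    then obtain i j a where ij: "i < j" "a \<in> exps d" "e j = a + e i" by (rule dickson_seq)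
    then have "e i = e j" using B[of i] B[of j] by (auto simp: B_def)
    then show False using e(1) \<open>i < j\<close> by (auto dest: injD)
  qed
  show "\<forall>e\<in>L. \<exists>b\<in>B. \<exists>a\<in>exps d. e = a + b"
  proof
    fix e assume e: "e \<in> L"
    define D where "D b \<longleftrightarrow> b \<in> L \<and> (\<exists>a\<in>exps d. e = a + b)" for b
    have "D e" using e by (auto simp: D_def intro!: bexI[of _ 0])
    then obtain b where b: "D b" "\<And>c. D c \<Longrightarrow> edeg d b \<le> edeg d c"
      using ex_has_least_nat[of D e "edeg d"] by blast
    have "b \<in> B"
      unfolding B_def
    proof (intro CollectI conjI ballI impI)
      show "b \<in> L" using b(1) by (simp add: D_def)
      fix c a assume c: "c \<in> L" "a \<in> exps d" "b = a + c"
      obtain a' where a': "a' \<in> exps d" "e = a' + b" using b(1) by (auto simp: D_def)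
      then have "e = (a' + a) + c" "a' + a \<in> exps d" using c by (simp_all add: add.assoc)
      then have "D c" using c(1) unfolding D_def by blast
      then have "edeg d a = 0" using b(2)[of c] by (simp add: c edeg_add)
      then show "c = b" using edeg_eq_0_iff[OF c(2)] c(3) by simp
    qed
    then show "\<exists>b\<in>B. \<exists>a\<in>exps d. e = a + b" using b(1) by (auto simp: D_def)
  qed
qed

section \<open>The lexicographic monomial order and division\<close>

lemma exps_lex_nonneg: "0 \<le> (a :: nat \<Rightarrow>\<^sub>0 nat)"
proof -
  have "\<not> a < 0" by (simp add: less_poly_mapping.rep_eq less_fun_def)
  then show ?thesis by simp
qed

text \<open>The library order on exponents is lexicographic, hence no well-order on all of
  \<open>nat \<Rightarrow>\<^sub>0 nat\<close>, but on finitely many variables Dickson's lemma makes it one.\<close>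

lemma exps_lex_least:
  assumes "S \<subseteq> exps d" "S \<noteq> {}"
  obtains m where "m \<in> S" "\<forall>e\<in>S. m \<le> e"
proof -
  have "wf {(a, b). a < b \<and> a \<in> S \<and> b \<in> S}"
    unfolding wf_iff_no_infinite_down_chain
  proof
    assume "\<exists>f. \<forall>i. (f (Suc i), f i) \<in> {(a, b). a < b \<and> a \<in> S \<and> b \<in> S}"
    then obtain f where f: "\<And>i. f (Suc i) < f i" "\<And>i. f i \<in> S" by blast
    then have "f n \<in> exps d" for n using assms(1) by blast
    then obtain i j a where ij: "i < j" "f j = a + f i" by (rule dickson_seq)
    have "f j < f i" using ij(1) by (rule less_Suc_induct) (fact f(1), rule less_trans)
    \<comment> \<open>Nonnegativity and translation invariance make a multiple at least as large as
      its divisor, so Dickson's lemma excludes infinite descent.\<close>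
    moreover have "f i \<le> a + f i" using add_right_mono[OF exps_lex_nonneg[of a], of "f i"] by simp
    ultimately show False using ij by simp
  qed
  then obtain m where m: "m \<in> S" "\<forall>y. (y, m) \<in> {(a, b). a < b \<and> a \<in> S \<and> b \<in> S} \<longrightarrow> y \<notin> S"
    using assms(2) unfolding wf_eq_minimal by blast
  have "m \<le> e" if "e \<in> S" for e
    using m(2) m(1) that by (cases "e < m") auto
  then show ?thesis using m(1) that by blast
qed

text \<open>The leading exponent for the lexicographic order. At the zero polynomial it is the
  maximum of an empty set, hence the separate treatment of zero below.\<close>

definition lead_exp :: "'k::field poly_nat_vars \<Rightarrow> nat \<Rightarrow>\<^sub>0 nat" where
  "lead_exp f = Max (Poly_Mapping.keys f)"

lemma lead_exp_in_keys: "f \<noteq> 0 \<Longrightarrow> lead_exp f \<in> Poly_Mapping.keys f"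
  unfolding lead_exp_def by (intro Max_in) auto

lemma keys_le_lead_exp: "e \<in> Poly_Mapping.keys f \<Longrightarrow> e \<le> lead_exp f"
  unfolding lead_exp_def by (intro Max_ge) auto

lemma lead_exp_exps: "f \<noteq> 0 \<Longrightarrow> f \<in> polys d \<Longrightarrow> lead_exp f \<in> exps d"
  using lead_exp_in_keys[of f] by (auto simp: polys_iff)

text \<open>One step of polynomial division: the ratio of leading coefficients cancels the top term,
  and translation invariance keeps all other exponents below it.\<close>

lemma lead_term_reduction:
  fixes f g :: "'k::field poly_nat_vars"
  assumes "f \<noteq> 0" "g \<noteq> 0" and eq: "lead_exp g = a + lead_exp f"
  obtains r where "g - const r * (monom a * f) = 0 \<or> lead_exp (g - const r * (monom a * f)) < lead_exp g"
proof -
  define r where "r = Poly_Mapping.lookup g (lead_exp g) / Poly_Mapping.lookup f (lead_exp f)"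
  define h where "h = g - const r * (monom a * f)"
  have lk: "Poly_Mapping.lookup h b =
      Poly_Mapping.lookup g b - r * Poly_Mapping.lookup (monom a * f) b" for b
    by (simp add: h_def lookup_minus lookup_const_mult)
  have "Poly_Mapping.lookup f (lead_exp f) \<noteq> 0"
    using lead_exp_in_keys[OF assms(1)] by (simp add: in_keys_iff)
  then have 0: "Poly_Mapping.lookup h (lead_exp g) = 0"
    unfolding lk by (simp add: eq lookup_monom_mult r_def flip: eq) (simp add: eq lookup_monom_mult)
  have le: "b \<le> lead_exp g" if "b \<in> Poly_Mapping.keys h" for b
  proof -
    have "b \<in> Poly_Mapping.keys g \<or> b \<in> Poly_Mapping.keys (monom a * f)"
      using that by (auto simp: in_keys_iff lk)
    then show ?thesis
    proof
      assume "b \<in> Poly_Mapping.keys (monom a * f)"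
      then obtain c where "c \<in> Poly_Mapping.keys f" "b = a + c"
        using keys_mult[of "monom a" f] by auto
      then show ?thesis using keys_le_lead_exp[of c f] by (simp add: eq add_left_mono)
    qed (rule keys_le_lead_exp)
  qed
  have "lead_exp h < lead_exp g" if "h \<noteq> 0"
    using le[OF lead_exp_in_keys[OF that]] lead_exp_in_keys[OF that] 0
    by (metis in_keys_iff order_le_less)
  then show ?thesis using that[of r] by (auto simp: h_def)
qed

text \<open>The Groebner basis argument: polynomials realizing a finite divisibility basis of the
  leading exponents of \<open>I\<close> generate \<open>I\<close>.\<close>

lemma noetherian_ring_loc_ring: "noetherian_ring (loc_ring d :: 'k::field poly_nat_vars fract ring)"
proof -
  let ?R = "loc_ring d :: 'k poly_nat_vars fract ring"
  interpret R: cring ?R by (rule cring_loc_ring)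
  show ?thesis
  proof (rule R.noetherian_ringI)
    fix I assume I: "ideal I ?R"
    \<comment> \<open>Denominators are units, so an ideal of the localization is generated by the
      polynomials it contains, and those have leading exponents.\<close>
    define F where "F = {f \<in> polys d. f \<noteq> 0 \<and> Fract f 1 \<in> I}"
    have "lead_exp ` F \<subseteq> exps d" using lead_exp_exps by (auto simp: F_def)
    then obtain B where B: "finite B" "B \<subseteq> lead_exp ` F"
        "\<forall>e\<in>lead_exp ` F. \<exists>b\<in>B. \<exists>a\<in>exps d. e = a + b"
      by (rule dickson_finite_basis)
    obtain G where G: "G \<subseteq> F" "finite G" "B = lead_exp ` G"
      using finite_subset_image[OF B(1,2)] by blast
    define A where "A = (\<lambda>f. Fract f 1) ` G"
    have AI: "A \<subseteq> I" using G(1) by (auto simp: A_def F_def)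
    then have Ac: "A \<subseteq> carrier ?R" using ideal_loc_ringD(1)[OF I] by auto
    have J: "ideal (Idl\<^bsub>?R\<^esub> A) ?R" using Ac by (rule R.genideal_ideal)
    have JI: "Idl\<^bsub>?R\<^esub> A \<subseteq> I" using I AI by (rule R.genideal_minimal)
    have F: "Fract f 1 \<in> Idl\<^bsub>?R\<^esub> A" if "f \<in> F" for f
    proof (rule ccontr)
      assume f: "Fract f 1 \<notin> Idl\<^bsub>?R\<^esub> A"
      \<comment> \<open>Take a counterexample with least leading exponent; reducing it by a chosen
        generator produces another with a smaller one.\<close>
      define S where "S = lead_exp ` {f \<in> F. Fract f 1 \<notin> Idl\<^bsub>?R\<^esub> A}"
      have "S \<subseteq> exps d" "S \<noteq> {}" using f that \<open>lead_exp ` F \<subseteq> exps d\<close> by (auto simp: S_def)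
      then obtain m where m: "m \<in> S" "\<forall>e\<in>S. m \<le> e" by (rule exps_lex_least)
      obtain g where g: "g \<in> F" "Fract g 1 \<notin> Idl\<^bsub>?R\<^esub> A" "m = lead_exp g"
        using m(1) by (auto simp: S_def)
      obtain b a where "b \<in> B" and a: "a \<in> exps d" "lead_exp g = a + b" using B(3) g(1) by blast
      then obtain h where h: "h \<in> G" "b = lead_exp h" using G(3) by blast
      have hF: "h \<in> F" using h G(1) by blast
      obtain r where r: "g - const r * (monom a * h) = 0 \<or>
          lead_exp (g - const r * (monom a * h)) < lead_exp g"
        using lead_term_reduction[of h g a] g(1) hF a h(2) by (auto simp: F_def)
      define g' where "g' = g - const r * (monom a * h)"
      have hA: "Fract h 1 \<in> Idl\<^bsub>?R\<^esub> A" using R.genideal_self[OF Ac] h by (auto simp: A_def)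
      have "Fract (const r * monom a) 1 * Fract h 1 \<in> Idl\<^bsub>?R\<^esub> A"
        using a by (intro ideal_loc_ringD(5)[OF J _ hA] Fract_in_carrier) auto
      then have t: "Fract (const r * (monom a * h)) 1 \<in> Idl\<^bsub>?R\<^esub> A" by (simp add: mult.assoc)
      have eq: "Fract g 1 = Fract g' 1 + Fract (const r * (monom a * h)) 1" by (simp add: g'_def)
      have notin: "Fract g' 1 \<notin> Idl\<^bsub>?R\<^esub> A"
        using g(2) ideal_loc_ringD(3)[OF J _ t] unfolding eq by blast
      then have "g' \<noteq> 0" using ideal_loc_ringD(2)[OF J] by (auto simp: fract_collapse)
      have "Fract g' 1 = Fract g 1 - Fract (const r * (monom a * h)) 1" by (simp add: eq)
      also have "\<dots> \<in> I" using g(1) t JI by (intro ideal_loc_ringD(4)[OF I]) (auto simp: F_def)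
      finally have "Fract g' 1 \<in> I" .
      moreover have "g' \<in> polys d"
        unfolding g'_def diff_conv_add_uminus using g(1) hF a by (intro polys_add polys_intros) (auto simp: F_def)
      ultimately have "lead_exp g' \<in> S" using \<open>g' \<noteq> 0\<close> notin by (auto simp: S_def F_def)
      then have "lead_exp g \<le> lead_exp g'" using m(2) g(3) by blast
      then show False using r \<open>g' \<noteq> 0\<close> by (simp add: g'_def)
    qed
    have "I \<subseteq> Idl\<^bsub>?R\<^esub> A"
    proof
      fix x assume x: "x \<in> I"
      then have "x \<in> mono_ideal d (exps d)" using ideal_loc_ringD(1)[OF I] by blast
      then obtain f g where fg: "x = Fract f g" "Poly_Mapping.keys f \<subseteq> exps d" "g \<in> denoms d" "g \<noteq> 0"
        by (rule mono_idealE)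
      have eq: "Fract g 1 * x = Fract f 1" "Fract 1 g * Fract f 1 = x"
        using fg by (simp_all add: eq_fract)
      have "Fract g 1 * x \<in> I"
        by (intro ideal_loc_ringD(5)[OF I] Fract_in_carrier denoms_polys fg x)
      then have "Fract f 1 \<in> Idl\<^bsub>?R\<^esub> A"
        unfolding eq(1) using F[of f] fg(2) ideal_loc_ringD(2)[OF J]
        by (cases "f = 0") (simp_all add: F_def polys_iff fract_collapse)
      then have "Fract 1 g * Fract f 1 \<in> Idl\<^bsub>?R\<^esub> A"
        using fg(3) by (intro ideal_loc_ringD(5)[OF J] mono_idealI) auto
      then show "x \<in> Idl\<^bsub>?R\<^esub> A" unfolding eq(2) .
    qed
    then show "\<exists>A\<subseteq>carrier ?R. finite A \<and> I = Idl\<^bsub>?R\<^esub> A"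
      using JI Ac G(2) by (intro exI[of _ A]) (auto simp: A_def)
  qed
qed

section \<open>The counterexample\<close>

lemma one_notin_mono_ideal_exps_ge:
  "t > 0 \<Longrightarrow> 1 \<notin> (mono_ideal d (exps_ge d t) :: 'k::field poly_nat_vars fract set)"
  using Fract_monom_in_mono_ideal_iff[of 0 d "exps_ge d t", where ?'k = 'k]
  by (simp add: fract_collapse exps_ge_def)

lemma loc_ring_unit':
  assumes "x \<in> mono_ideal d (exps d)" "x \<notin> loc_max d"
  obtains y where "y \<in> mono_ideal d (exps d)" "x * y = 1"
  using assms loc_ring_unit unfolding loc_max_eq by blast

lemma ideal_loc_max: "ideal (loc_max d) (loc_ring d)"
  unfolding loc_max_mono_ideal by (rule ideal_mono_ideal) simp

lemma one_notin_loc_max: "1 \<notin> loc_max d"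
  unfolding loc_max_mono_ideal by (rule one_notin_mono_ideal_exps_ge) simp

text \<open>Everything outside \<open>loc_max d\<close> is a unit. This yields both the maximality
  and the uniqueness of this ideal.\<close>

lemma proper_ideal_le_loc_max:
  assumes K: "ideal K (loc_ring d)" and "1 \<notin> K"
  shows "K \<subseteq> loc_max d"
proof
  fix x assume x: "x \<in> K"
  show "x \<in> loc_max d"
  proof (rule ccontr)
    assume "x \<notin> loc_max d"
    then obtain y where y: "y \<in> mono_ideal d (exps d)" "x * y = 1"
      using loc_ring_unit' x ideal_loc_ringD(1)[OF K] by blast
    then have "y * x = 1" by (simp add: mult.commute)
    then show False using ideal_loc_ringD(5)[OF K y(1) x] \<open>1 \<notin> K\<close> by simp
  qed
qed

lemma one_in_ideal_imp_carrier:
  assumes "ideal K (loc_ring d)" "1 \<in> K"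
  shows "K = carrier (loc_ring d)"
  using ideal.one_imp_carrier[OF assms(1)] assms(2) by simp

lemma maximalideal_loc_ring_iff: "maximalideal M (loc_ring d) \<longleftrightarrow> M = loc_max d"
proof
  have carr: "carrier (loc_ring d) \<noteq> loc_max d"
    using one_notin_loc_max[of d] one_in_carrier[of d] unfolding loc_ring_simps by metis
  assume "maximalideal M (loc_ring d)"
  then interpret maximalideal M "loc_ring d" .
  have "1 \<notin> M" using one_in_ideal_imp_carrier[OF is_ideal] I_notcarr by blast
  then have "M \<subseteq> loc_max d" by (rule proper_ideal_le_loc_max[OF is_ideal])
  then show "M = loc_max d"
    using I_maximal[OF ideal_loc_max] ideal_loc_ringD(1)[OF ideal_loc_max] carr by auto
next
  assume M: "M = loc_max d"
  show "maximalideal M (loc_ring d)"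
    unfolding M
  proof (rule maximalidealI[OF ideal_loc_max])
    show "carrier (loc_ring d) \<noteq> loc_max d"
      using one_notin_loc_max[of d] one_in_carrier[of d] unfolding loc_ring_simps by metis
    fix J assume "ideal J (loc_ring d)" "loc_max d \<subseteq> J" "J \<subseteq> carrier (loc_ring d)"
    then show "J = loc_max d \<or> J = carrier (loc_ring d)"
      using proper_ideal_le_loc_max one_in_ideal_imp_carrier by blast
  qed
qed

lemma power_in_mono_ideal_exps_ge: "x \<in> loc_max d \<Longrightarrow> x ^ n \<in> mono_ideal d (exps_ge d n)"
proof (induction n)
  case 0
  have "exps_ge d 0 = exps d" by (simp add: exps_ge_def)
  then show ?case by simp
next
  case (Suc n)
  have "a + b \<in> exps_ge d (Suc n)" if "a \<in> exps_ge d 1" "b \<in> exps_ge d n" for a b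
    using that by (auto simp: exps_ge_def edeg_add)
  from mono_ideal_mult[OF this _ Suc.IH[OF Suc.prems]] Suc.prems
  show ?case by (simp add: loc_max_mono_ideal)
qed

text \<open>If \<open>y\<close> is not in the maximal ideal, it is a unit and can be cancelled from
  \<open>x * y\<close>. The t-th power of any element of the maximal ideal lies in its t-th power,
  which identifies the radical.\<close>

lemma primary_to_mono_ideal_exps_ge:
  assumes "t > 0"
  shows "primary_to (loc_ring d) (loc_max d) (mono_ideal d (exps_ge d t) :: 'k::field poly_nat_vars fract set)"
proof -
  let ?R = "loc_ring d :: 'k poly_nat_vars fract ring"
  let ?J = "mono_ideal d (exps_ge d t) :: 'k poly_nat_vars fract set"
  have J: "ideal ?J ?R" by (rule ideal_mono_ideal) simp
  have one: "1 \<notin> ?J" using assms by (rule one_notin_mono_ideal_exps_ge)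
  have rad: "ideal_radical ?R ?J = loc_max d"
  proof
    show "ideal_radical ?R ?J \<subseteq> loc_max d"
    proof
      fix x assume "x \<in> ideal_radical ?R ?J"
      then obtain n where x: "x \<in> mono_ideal d (exps d)" "x ^ n \<in> ?J"
        by (auto simp: ideal_radical_def)
      show "x \<in> loc_max d"
      proof (rule ccontr)
        assume "x \<notin> loc_max d"
        then obtain y where y: "y \<in> mono_ideal d (exps d)" "x * y = 1"
          using x(1) loc_ring_unit' by blast
        have "y ^ n * x ^ n \<in> ?J" by (rule ideal_loc_ringD(5)[OF J carrier_power[OF y(1)] x(2)])
        also have "y ^ n * x ^ n = 1" using y(2) by (simp add: mult.commute flip: power_mult_distrib)
        finally show False using one by simp
      qed
    qed
    show "loc_max d \<subseteq> ideal_radical ?R ?J"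
      using power_in_mono_ideal_exps_ge[of _ d t] ideal_loc_ringD(1)[OF ideal_loc_max[of d, where ?'a = 'k]]
      by (auto simp: ideal_radical_def)
  qed
  have "x \<in> ?J \<or> y \<in> loc_max d"
    if xy: "x \<in> mono_ideal d (exps d)" "y \<in> mono_ideal d (exps d)" "x * y \<in> ?J" for x y
  proof (rule disjCI)
    assume "y \<notin> loc_max d"
    then obtain z where z: "z \<in> mono_ideal d (exps d)" "y * z = 1" using xy(2) loc_ring_unit' by blast
    have "z * (x * y) \<in> ?J" by (rule ideal_loc_ringD(5)[OF J z(1) xy(3)])
    also have "z * (x * y) = x * (y * z)" by (simp only: mult_ac)
    finally show "x \<in> ?J" using z(2) by simp
  qed
  moreover have "?J \<noteq> carrier ?R" using one one_in_carrier[of d] unfolding loc_ring_simps by metis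
  ultimately show ?thesis using J rad by (simp add: primary_to_def)
qed

lemma Idl_loc_vars: "Idl\<^bsub>loc_ring d\<^esub> (loc_var ` {..<d}) = (loc_max d :: 'k::field poly_nat_vars fract set)"
proof -
  let ?R = "loc_ring d :: 'k poly_nat_vars fract ring"
  let ?V = "loc_var ` {..<d} :: 'k poly_nat_vars fract set"
  interpret R: cring ?R by (rule cring_loc_ring)
  have sub: "?V \<subseteq> loc_max d"
    by (auto simp: loc_max_mono_ideal loc_var_eq Fract_monom_in_mono_ideal_iff exps_ge_def)
  then have V: "?V \<subseteq> carrier ?R"
    using ideal_loc_ringD(1)[OF ideal_loc_max[of d, where ?'a = 'k]] by simp
  then have I: "ideal (Idl\<^bsub>?R\<^esub> ?V) ?R" by (rule R.genideal_ideal)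
  have "mono_ideal d (exps_ge d 1) \<subseteq> Idl\<^bsub>?R\<^esub> ?V"
  proof (rule mono_ideal_least[OF I])
    fix e assume "e \<in> exps_ge d 1"
    then have "e \<in> exps_ge d (Suc 0)" by simp
    then obtain a i where ai: "i < d" "a \<in> exps_ge d 0" "e = a + Poly_Mapping.single i 1"
      by (rule monom_var_factor)
    have "loc_var i \<in> Idl\<^bsub>?R\<^esub> ?V" using R.genideal_self[OF V] ai(1) by blast
    then have "Fract (monom a) 1 * loc_var i \<in> Idl\<^bsub>?R\<^esub> ?V"
      using ai(2) by (intro ideal_loc_ringD(5)[OF I]) (auto simp: Fract_monom_in_mono_ideal_iff exps_ge_def)
    then show "Fract (monom e) 1 \<in> Idl\<^bsub>?R\<^esub> ?V" by (simp add: ai(3) loc_var_eq monom_mult)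
  qed
  then show ?thesis
    using R.genideal_minimal[OF ideal_loc_max sub] by (auto simp: loc_max_mono_ideal)
qed

lemma add_pow_loc_ring: "add_pow (loc_ring d) (n::nat) 1 = of_nat n"
  by (induction n) (simp_all add: add_pow_def)

lemma SB_hypotheses_loc_ring:
  fixes R :: "'k::field poly_nat_vars fract ring"
  assumes p: "Factorial_Ring.prime p" "CHAR('k) = p" and "d > 0" "t > 0" and R: "R = loc_ring d"
  shows "SB_hypotheses p R (loc_max d) (map loc_var [0..<d]) (ideal_power R (loc_max d) t)"
proof -
  have "noetherian_local R (loc_max d)"
    unfolding noetherian_local_def R
    by (simp add: cring_loc_ring noetherian_ring_loc_ring maximalideal_loc_ring_iff)
  moreover have "add_pow R p \<one>\<^bsub>R\<^esub> = \<zero>\<^bsub>R\<^esub>"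
  proof -
    have "(of_nat p :: 'k poly_nat_vars) = 0"
      using CHAR_poly_nat_vars[where ?'k = 'k] p(2) by (metis of_nat_CHAR)
    then have "(of_nat p :: 'k poly_nat_vars fract) = 0"
      by (simp add: of_nat_fract fract_collapse)
    then show ?thesis by (simp add: R add_pow_loc_ring)
  qed
  moreover have "part_of_sop R (loc_max d) (map loc_var [0..<d])"
    unfolding part_of_sop_def
  \<comment> \<open>The \<open>d\<close> variables already form a full system of parameters, so the
    completing list is empty.\<close>
  proof (intro exI[of _ "[]"] conjI)
    have I: "Idl\<^bsub>R\<^esub> (set (map loc_var [0..<d] @ [])) = loc_max d"
      using Idl_loc_vars[of d, where ?'k = 'k] by (simp add: R lessThan_atLeast0)
    show "set (map loc_var [0..<d] @ []) \<subseteq> (loc_max d :: 'k poly_nat_vars fract set)"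
      by (auto simp: loc_max_mono_ideal loc_var_eq Fract_monom_in_mono_ideal_iff exps_ge_def)
    show "enat (length (map loc_var [0..<d] @ [])) = krull_dim R"
      by (simp add: R krull_dim_loc_ring)
    show "primary_to R (loc_max d) (Idl\<^bsub>R\<^esub> (set (map loc_var [0..<d] @ [])))"
      unfolding I unfolding R using primary_to_mono_ideal_exps_ge[of 1 d]
      by (simp add: loc_max_mono_ideal)
  qed
  moreover have "primary_to R (loc_max d) (ideal_power R (loc_max d) t)"
    unfolding R ideal_power_loc_max using \<open>t > 0\<close> by (rule primary_to_mono_ideal_exps_ge)
  ultimately show ?thesis using p \<open>d > 0\<close> by (simp add: SB_hypotheses_def)
qed

text \<open>For positive \<open>t\<close> the power of the maximal ideal vanishes in the residue
  field, which reduces the claim to the zero ideal of a field.\<close>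

lemma e_HK_residue_field:
  assumes "p > 0" "t > 0" and R: "R = loc_ring d"
  shows "e_HK p (R Quot loc_max d) (quot_extension R (loc_max d) (ideal_power R (loc_max d) t)) = 1"
proof -
  have "exps_ge d t \<subseteq> exps_ge d 1" using \<open>t > 0\<close> by (auto simp: exps_ge_def)
  then have "ideal_power R (loc_max d) t \<subseteq> loc_max d"
    unfolding R ideal_power_loc_max unfolding loc_max_mono_ideal by (rule mono_ideal_mono)
  moreover have "ideal_power R (loc_max d) t \<noteq> {}"
    unfolding R ideal_power_loc_max using mono_ideal_0 by blast
  ultimately have "quot_extension R (loc_max d) (ideal_power R (loc_max d) t) = {\<zero>\<^bsub>R Quot loc_max d\<^esub>}"
    using ideal_loc_max unfolding R by (intro quot_extension_eq_zero)
  moreover have "maximalideal (loc_max d) R" by (simp add: R maximalideal_loc_ring_iff)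
  then have "field (R Quot loc_max d)"
    using cring_loc_ring unfolding R by (rule maximalideal.quotient_is_field)
  ultimately show ?thesis using field.e_HK_zero_ideal \<open>p > 0\<close> by metis
qed

theorem proposition8p16:
  fixes d p :: nat
    and R :: "('k::field) poly_nat_vars fract ring"
    and \<mm> :: "('k::field) poly_nat_vars fract set"
  assumes "Factorial_Ring.prime p" and "CHAR('k) = p" and "d \<ge> 2"
    and "R = loc_ring d" and "\<mm> = loc_max d"
  shows "\<forall>\<^sub>F t in sequentially.
    (let J = ideal_power R \<mm> t; I = \<mm>; xs = map loc_var [0..<d] in
       e_HK p R J >
         (F_threshold p R J I / real d) ^ d * e_HK p (R Quot I) (quot_extension R I J) \<and>
       I = Idl\<^bsub>R\<^esub> (set xs) \<and> SB_hypotheses p R \<mm> xs J \<and> \<not> SB_inequality p R xs J)"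
proof (rule eventually_sequentiallyI)
  \<comment> \<open>The threshold 2 is the first that works: at \<open>t = 1\<close> the upper
    binomial index equals \<open>d\<close> and both sides are 1.\<close>
  fix t :: nat assume "2 \<le> t"
  then have "t > 0" "d < t - 1 + d" "d > 0" using \<open>d \<ge> 2\<close> by simp_all
  define J where "J = ideal_power R \<mm> t"
  have "p > 0" using assms(1) by (simp add: prime_gt_0_nat)
  have Idl: "Idl\<^bsub>R\<^esub> (set (map loc_var [0..<d])) = \<mm>"
    using Idl_loc_vars[of d, where ?'k = 'k] by (simp add: assms(4,5) lessThan_atLeast0)
  have "e_HK p R J = real ((t - 1 + d) choose d)"
    unfolding J_def assms(5)
    by (rule e_HK_loc_max_power[OF assms(1,2) \<open>t > 0\<close> assms(4)]) (simp add: assms(4) krull_dim_loc_ring)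
  moreover have "F_threshold p R J \<mm> = real (t - 1 + d)"
    unfolding J_def assms(5) by (rule F_threshold_loc_max[OF assms(1,2) \<open>d > 0\<close> \<open>t > 0\<close> assms(4)])
  moreover have "e_HK p (R Quot \<mm>) (quot_extension R \<mm> J) = 1"
    unfolding J_def assms(5) by (rule e_HK_residue_field[OF \<open>p > 0\<close> \<open>t > 0\<close> assms(4)])
  ultimately have less: "(F_threshold p R J \<mm> / real d) ^ d *
      e_HK p (R Quot \<mm>) (quot_extension R \<mm> J) < e_HK p R J"
    using binomial_gt_power[OF \<open>d \<ge> 2\<close> \<open>d < t - 1 + d\<close>] by simp
  have "SB_hypotheses p R \<mm> (map loc_var [0..<d]) J"
    unfolding J_def assms(5) by (rule SB_hypotheses_loc_ring[OF assms(1,2) \<open>d > 0\<close> \<open>t > 0\<close> assms(4)])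
  moreover have "\<not> SB_inequality p R (map loc_var [0..<d]) J"
    using less unfolding SB_inequality_def Let_def Idl by simp
  ultimately show "let J = ideal_power R \<mm> t; I = \<mm>; xs = map loc_var [0..<d] in
       e_HK p R J >
         (F_threshold p R J I / real d) ^ d * e_HK p (R Quot I) (quot_extension R I J) \<and>
       I = Idl\<^bsub>R\<^esub> (set xs) \<and> SB_hypotheses p R \<mm> xs J \<and> \<not> SB_inequality p R xs J"
    using less Idl unfolding Let_def J_def by simp
qed

end
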